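(* Let $\{\mathbf{D}_j\}_{j=1}^n$ be a collection of distributive lattices such that each $\mathbf{D}_j$ is of one of the following five types: (1) a distributive lattice $\mathbf{D}$ such that the poset $\mathrm{MI}(\mathbf{D})$ of meet-irreducible elements of $\mathbf{D}$ is isomorphic, as a poset, to $T^\partial$ for some finite rooted tree $T$; (2) a finite chain; (3) a countably infinite chain isomorphic to $(\mathbb{N}_0^\infty)^\partial$; (4) the underlying lattice of a finite subdirectly irreducible distributive p-algebra; (5) the underlying lattice of a finite Boolean algebra. Let $\mathbf{P}=\prod_{j=1}^n\mathbf{D}_j$. Then $\mathbf{P}$ is in the image of $\mathcal{K}^\circ\mathrm{X}$, i.e. there is a commutative BCK-algebra $\mathbf{A}$ such that $\mathbf{P}$ is isomorphic as a lattice to the lattice $\mathcal{K}^\circ\mathrm{X}(\mathbf{A})$ of compact open subsets of the spectrum $\mathrm{X}(\mathbf{A})$.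
   Context: A commutative BCK-algebra is an algebra $\mathbf{A}=\langle A;\cdot,0\rangle$ of type $(2,0)$ such that for all $x,y,z\in A$: $(x\cdot y)\cdot z=(x\cdot z)\cdot y$; $x\cdot(x\cdot y)=y\cdot(y\cdot x)$; $x\cdot x=0$; $x\cdot 0=x$. Put $x\wedge y:=y\cdot(y\cdot x)$. An ideal is a subset $I\subseteq A$ with $0\in I$ such that $x\cdot y\in I$ and $y\in I$ imply $x\in I$. An ideal $P$ is prime if $P\neq A$ and $x\wedge y\in P$ implies $x\in P$ or $y\in P$. The spectrum of $\mathbf{A}$ is the set $\mathrm{X}(\mathbf{A})$ of prime ideals of $\mathbf{A}$ with the topology whose open sets are exactly the sets $\sigma(I)=\{P\in\mathrm{X}(\mathbf{A})\mid I\not\subseteq P\}$, $I$ an ideal of $\mathbf{A}$. The compact open subsets of $\mathrm{X}(\mathbf{A})$ are closed under finite unions and pairwise intersections; ordered by inclusion they form a distributive lattice with $0$, denoted $\mathcal{K}^\circ\mathrm{X}(\mathbf{A})$ ("compact" does not include Hausdorff). Meet-irreducible elements exclude the top element: $m\in\mathrm{MI}(\mathbf{D})$ iff $m$ is not the top and $m=a\wedge b$ implies $m=a$ or $m=b$. A rooted tree $T$ with root $\lambda$ is regarded as a poset with $\alpha\le\beta$ iff $\alpha$ is $\beta$ or an ancestor of $\beta$ (so the root is the least element), and $T^\partial$ denotes its order-dual. $\mathbb{N}_0^\infty=\{0,1,2,\dots\}\cup\{\infty\}$ with its usual order and $k<\infty$ for all $k\in\{0,1,2,\dots\}$, and $(\mathbb{N}_0^\infty)^\partial$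 is its order-dual. A p-algebra is a pseudocomplemented lattice, i.e. a bounded lattice with a unary operation ${}^\ast$ (part of the signature) such that $x\wedge y=0\iff y\le x^\ast$; it is distributive if its lattice is.
   Formalization: In type (1) the distributive lattice D is assumed finite; without this the claim fails, e.g. for ℤ×ℤ with a two-element chain c<t placed on top, where MI(D)={c} is the dual of a one-vertex tree but D has no least element. *)

theory Defs
  imports
    "HOL-Algebra.Lattice"
    "HOL-Analysis.Abstract_Topology"
    "HOL-Library.Extended_Nat"
begin

section \<open>Commutative BCK-algebras and their spectra\<close>

record 'a bck = "'a partial_object" +
  bck_sub :: "'a \<Rightarrow> 'a \<Rightarrow> 'a"  (infixl \<open>\<cdot>\<index>\<close> 75)
  bck_zero :: "'a"  (\<open>\<zero>\<index>\<close>)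

locale commutative_bck =
  fixes A (structure)
  assumes zero_closed: "\<zero> \<in> carrier A"
    and sub_closed: "\<lbrakk>x \<in> carrier A; y \<in> carrier A\<rbrakk> \<Longrightarrow> x \<cdot> y \<in> carrier A"
    and sub_right_commute: "\<lbrakk>x \<in> carrier A; y \<in> carrier A; z \<in> carrier A\<rbrakk>
          \<Longrightarrow> (x \<cdot> y) \<cdot> z = (x \<cdot> z) \<cdot> y"
    and sub_sub_commute: "\<lbrakk>x \<in> carrier A; y \<in> carrier A\<rbrakk> \<Longrightarrow> x \<cdot> (x \<cdot> y) = y \<cdot> (y \<cdot> x)"
    and sub_self: "x \<in> carrier A \<Longrightarrow> x \<cdot> x = \<zero>"
    and sub_zero: "x \<in> carrier A \<Longrightarrow> x \<cdot> \<zero> = x"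

definition bck_meet :: "('a, 'm) bck_scheme \<Rightarrow> 'a \<Rightarrow> 'a \<Rightarrow> 'a" where
  "bck_meet A x y = y \<cdot>\<^bsub>A\<^esub> (y \<cdot>\<^bsub>A\<^esub> x)"

definition bck_ideal :: "('a, 'm) bck_scheme \<Rightarrow> 'a set \<Rightarrow> bool" where
  "bck_ideal A I \<longleftrightarrow> I \<subseteq> carrier A \<and> \<zero>\<^bsub>A\<^esub> \<in> I \<and>
     (\<forall>x\<in>carrier A. \<forall>y\<in>carrier A. x \<cdot>\<^bsub>A\<^esub> y \<in> I \<and> y \<in> I \<longrightarrow> x \<in> I)"

definition bck_prime_ideal :: "('a, 'm) bck_scheme \<Rightarrow> 'a set \<Rightarrow> bool" where
  "bck_prime_ideal A P \<longleftrightarrow> bck_ideal A P \<and> P \<noteq> carrier A \<and>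
     (\<forall>x\<in>carrier A. \<forall>y\<in>carrier A. bck_meet A x y \<in> P \<longrightarrow> x \<in> P \<or> y \<in> P)"

definition bck_sigma :: "('a, 'm) bck_scheme \<Rightarrow> 'a set \<Rightarrow> 'a set set" where
  "bck_sigma A I = {P. bck_prime_ideal A P \<and> \<not> I \<subseteq> P}"

definition bck_spectrum :: "('a, 'm) bck_scheme \<Rightarrow> 'a set topology" where
  "bck_spectrum A = topology (\<lambda>U. \<exists>I. bck_ideal A I \<and> U = bck_sigma A I)"

lemma (in commutative_bck) meet_mem_ideal:
  assumes I: "bck_ideal A I" and x: "x \<in> carrier A" and y: "y \<in> carrier A"
    and "x \<in> I \<or> y \<in> I"
  shows "bck_meet A x y \<in> I"
proof -
  have *: "v \<cdot> (v \<cdot> u) \<in> I" if "u \<in> carrier A" "v \<in> carrier A" "u \<in> I" for u v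
  proof -
    have "(v \<cdot> (v \<cdot> u)) \<cdot> u = (v \<cdot> u) \<cdot> (v \<cdot> u)"
      using that by (intro sub_right_commute sub_closed)
    also have "\<dots> = \<zero>"
      using that by (intro sub_self sub_closed)
    finally have "(v \<cdot> (v \<cdot> u)) \<cdot> u \<in> I"
      using I by (simp add: bck_ideal_def)
    moreover have "v \<cdot> (v \<cdot> u) \<in> carrier A"
      using that by (intro sub_closed)
    ultimately show ?thesis
      using I that unfolding bck_ideal_def by blast
  qed
  show ?thesis
    using assms(4) *[OF x y] *[OF y x] sub_sub_commute[OF x y] by (auto simp: bck_meet_def)
qed

lemma (in commutative_bck) istopology_sigma:
  "istopology (\<lambda>U. \<exists>I. bck_ideal A I \<and> U = bck_sigma A I)"
  unfolding istopology_def
proof (intro conjI allI impI)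
  fix S T
  assume "\<exists>I. bck_ideal A I \<and> S = bck_sigma A I" "\<exists>J. bck_ideal A J \<and> T = bck_sigma A J"
  then obtain I J where I: "bck_ideal A I" "S = bck_sigma A I"
    and J: "bck_ideal A J" "T = bck_sigma A J" by blast
  have "P \<in> bck_sigma A (I \<inter> J)" if P: "P \<in> S" "P \<in> T" for P
  proof -
    obtain x y where xy: "x \<in> I" "x \<notin> P" "y \<in> J" "y \<notin> P"
      using P I J by (auto simp: bck_sigma_def)
    have c: "x \<in> carrier A" "y \<in> carrier A"
      using xy I J by (auto simp: bck_ideal_def)
    have "bck_meet A x y \<in> I \<inter> J"
      using meet_mem_ideal c xy I J by blast
    moreover have "bck_meet A x y \<notin> P"
      using P I xy c by (auto simp: bck_sigma_def bck_prime_ideal_def)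
    ultimately show ?thesis
      using P I by (auto simp: bck_sigma_def)
  qed
  then have "S \<inter> T = bck_sigma A (I \<inter> J)"
    using I J by (auto simp: bck_sigma_def)
  moreover have "bck_ideal A (I \<inter> J)"
    using I J by (auto simp: bck_ideal_def)
  ultimately show "\<exists>K. bck_ideal A K \<and> S \<inter> T = bck_sigma A K" by blast
next
  fix \<K>
  assume K: "\<forall>K\<in>\<K>. \<exists>I. bck_ideal A I \<and> K = bck_sigma A I"
  define F where "F = {I. bck_ideal A I \<and> bck_sigma A I \<in> \<K>}"
  define G where "G = carrier A \<inter> \<Inter>{M. bck_ideal A M \<and> \<Union>F \<subseteq> M}"
  have "bck_ideal A G"
    using zero_closed unfolding G_def bck_ideal_def by blast
  have "G \<subseteq> P \<longleftrightarrow> \<Union>F \<subseteq> P" if "bck_prime_ideal A P" for P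
  proof
    have "\<Union>F \<subseteq> G"
      unfolding G_def F_def bck_ideal_def by blast
    then show "\<Union>F \<subseteq> P" if "G \<subseteq> P"
      using that by (rule subset_trans)
    show "G \<subseteq> P" if "\<Union>F \<subseteq> P"
      using that \<open>bck_prime_ideal A P\<close> unfolding G_def bck_prime_ideal_def by blast
  qed
  then have "bck_sigma A G = {P. bck_prime_ideal A P \<and> \<not> \<Union>F \<subseteq> P}"
    unfolding bck_sigma_def by blast
  also have "\<dots> = \<Union>(bck_sigma A ` F)"
    unfolding bck_sigma_def by blast
  also have "bck_sigma A ` F = \<K>"
  proof
    show "bck_sigma A ` F \<subseteq> \<K>"
      by (auto simp: F_def)
    show "\<K> \<subseteq> bck_sigma A ` F"
    proof
      fix U assume "U \<in> \<K>"
      then obtain I where "bck_ideal A I" "U = bck_sigma A I"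
        using K by meson
      with \<open>U \<in> \<K>\<close> show "U \<in> bck_sigma A ` F"
        by (simp add: F_def)
    qed
  qed
  finally show "\<exists>I. bck_ideal A I \<and> \<Union>\<K> = bck_sigma A I"
    using \<open>bck_ideal A G\<close> by metis
qed

lemma (in commutative_bck) openin_bck_spectrum:
  "openin (bck_spectrum A) U \<longleftrightarrow> (\<exists>I. bck_ideal A I \<and> U = bck_sigma A I)"
  by (simp add: bck_spectrum_def topology_inverse' istopology_sigma)

definition compact_open_lattice :: "('a, 'm) bck_scheme \<Rightarrow> 'a set set gorder" where
  "compact_open_lattice A =
     \<lparr>carrier = {U. openin (bck_spectrum A) U \<and> compactin (bck_spectrum A) U},
      eq = (=), le = (\<subseteq>)\<rparr>"

section \<open>Lattices and posets\<close>

definition order_isomorphic :: "('a, 'm) gorder_scheme \<Rightarrow> ('b, 'n) gorder_scheme \<Rightarrow> bool" where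
  "order_isomorphic L M \<longleftrightarrow> (\<exists>f. bij_betw f (carrier L) (carrier M) \<and> order_emb L M f)"

definition lattice_isomorphic :: "('a, 'm) gorder_scheme \<Rightarrow> ('b, 'n) gorder_scheme \<Rightarrow> bool" where
  "lattice_isomorphic L M \<longleftrightarrow>
     (\<exists>f. bij_betw f (carrier L) (carrier M) \<and> join_pres L M f \<and> meet_pres L M f)"

text \<open>Lattices are nonempty; the locale \<^locale>\<open>lattice\<close> alone admits an empty carrier.\<close>

locale distributive_lattice = lattice +
  assumes carrier_nonempty: "carrier L \<noteq> {}"
    and meet_join_distrib: "\<lbrakk>x \<in> carrier L; y \<in> carrier L; z \<in> carrier L\<rbrakk>
          \<Longrightarrow> x \<sqinter> (y \<squnion> z) = (x \<sqinter> y) \<squnion> (x \<sqinter> z)"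

definition meet_irreducibles :: "('a, 'm) gorder_scheme \<Rightarrow> 'a set" where
  "meet_irreducibles L =
     {m \<in> carrier L. \<not> greatest L m (carrier L) \<and>
        (\<forall>a\<in>carrier L. \<forall>b\<in>carrier L. m = a \<sqinter>\<^bsub>L\<^esub> b \<longrightarrow> m = a \<or> m = b)}"

definition MI_poset :: "'a gorder \<Rightarrow> 'a gorder" where
  "MI_poset L = L\<lparr>carrier := meet_irreducibles L\<rparr>"

definition product_order :: "'i set \<Rightarrow> ('i \<Rightarrow> 'a gorder) \<Rightarrow> ('i \<Rightarrow> 'a) gorder" where
  "product_order I D =
     \<lparr>carrier = (\<Pi>\<^sub>E i\<in>I. carrier (D i)), eq = (=),
      le = (\<lambda>x y. \<forall>i\<in>I. x i \<sqsubseteq>\<^bsub>D i\<^esub> y i)\<rparr>"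

text \<open>A rooted tree is given by its parent-child edges, directed away from the root.\<close>

locale rooted_tree =
  fixes V :: "'v set" and E :: "('v \<times> 'v) set" and root :: 'v
  assumes edges: "E \<subseteq> V \<times> V"
    and root_vertex: "root \<in> V"
    and root_no_parent: "(u, root) \<notin> E"
    and unique_parent: "\<lbrakk>v \<in> V; v \<noteq> root\<rbrakk> \<Longrightarrow> \<exists>!u. (u, v) \<in> E"
    and reachable: "v \<in> V \<Longrightarrow> (root, v) \<in> E\<^sup>*"

definition ancestor_order :: "'v set \<Rightarrow> ('v \<times> 'v) set \<Rightarrow> 'v gorder" where
  "ancestor_order V E = \<lparr>carrier = V, eq = (=), le = (\<lambda>u v. (u, v) \<in> E\<^sup>*)\<rparr>"

definition enat_order :: "enat gorder" where
  "enat_order = \<lparr>carrier = UNIV, eq = (=), le = (\<le>)\<rparr>"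

locale boolean_lattice = distributive_lattice + bounded_lattice +
  assumes complement: "x \<in> carrier L \<Longrightarrow> \<exists>y\<in>carrier L. x \<sqinter> y = \<bottom> \<and> x \<squnion> y = \<top>"

section \<open>Distributive p-algebras\<close>

locale distributive_p_algebra = distributive_lattice + bounded_lattice +
  fixes pc :: "'a \<Rightarrow> 'a"
  assumes pc_closed: "x \<in> carrier L \<Longrightarrow> pc x \<in> carrier L"
    and pc_iff: "\<lbrakk>x \<in> carrier L; y \<in> carrier L\<rbrakk> \<Longrightarrow> x \<sqinter> y = \<bottom> \<longleftrightarrow> y \<sqsubseteq> pc x"

definition p_congruence :: "('a, 'm) gorder_scheme \<Rightarrow> ('a \<Rightarrow> 'a) \<Rightarrow> ('a \<times> 'a) set \<Rightarrow> bool" where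
  "p_congruence L pc \<theta> \<longleftrightarrow> equiv (carrier L) \<theta> \<and>
     (\<forall>(x, y)\<in>\<theta>. (pc x, pc y) \<in> \<theta>) \<and>
     (\<forall>(x, y)\<in>\<theta>. \<forall>(u, v)\<in>\<theta>. (x \<sqinter>\<^bsub>L\<^esub> u, y \<sqinter>\<^bsub>L\<^esub> v) \<in> \<theta> \<and> (x \<squnion>\<^bsub>L\<^esub> u, y \<squnion>\<^bsub>L\<^esub> v) \<in> \<theta>)"

text \<open>
  Subdirect irreducibility means having a least congruence above the identity (a monolith).
  The one-element algebra does not count as subdirectly irreducible.
\<close>

definition p_subdirectly_irreducible :: "('a, 'm) gorder_scheme \<Rightarrow> ('a \<Rightarrow> 'a) \<Rightarrow> bool" where
  "p_subdirectly_irreducible L pc \<longleftrightarrow>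
     (\<exists>\<mu>. p_congruence L pc \<mu> \<and> \<mu> \<noteq> Id_on (carrier L) \<and>
        (\<forall>\<theta>. p_congruence L pc \<theta> \<and> \<theta> \<noteq> Id_on (carrier L) \<longrightarrow> \<mu> \<subseteq> \<theta>))"

section \<open>The five kinds of factors\<close>

text \<open>
  Finiteness of the lattice is required in \<open>tree_type\<close>: an infinite lattice is not determined by
  its meet-irreducibles. The integer plane with a two-element chain placed on top has exactly one
  meet-irreducible element, but no least element, so it is no lattice of compact open sets.
  Taking the vertices of a finite tree to be natural numbers is no restriction.
\<close>

definition tree_type :: "'a gorder \<Rightarrow> bool" where
  "tree_type L \<longleftrightarrow> distributive_lattice L \<and> finite (carrier L) \<and>
     (\<exists>(V :: nat set) E root. finite V \<and> rooted_tree V E root \<and>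
        order_isomorphic (MI_poset L) (inv_gorder (ancestor_order V E)))"

definition finite_chain_type :: "'a gorder \<Rightarrow> bool" where
  "finite_chain_type L \<longleftrightarrow> total_order L \<and> finite (carrier L) \<and> carrier L \<noteq> {}"

definition infinite_chain_type :: "'a gorder \<Rightarrow> bool" where
  "infinite_chain_type L \<longleftrightarrow> total_order L \<and> order_isomorphic L (inv_gorder enat_order)"

definition p_algebra_type :: "'a gorder \<Rightarrow> bool" where
  "p_algebra_type L \<longleftrightarrow> finite (carrier L) \<and>
     (\<exists>pc. distributive_p_algebra L pc \<and> p_subdirectly_irreducible L pc)"

definition boolean_type :: "'a gorder \<Rightarrow> bool" where
  "boolean_type L \<longleftrightarrow> boolean_lattice L \<and> finite (carrier L)"

end

theory Submission
  imports Defs "HOL-Library.Function_Algebras" "HOL-Algebra.Complete_Lattice"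
begin

text \<open>
  The positive cone of an abelian lattice-ordered group, with \<open>x \<cdot> y = (x - y)\<^sup>+\<close>, is a
  commutative BCK-algebra, and its ideals are the traces of the convex \<open>\<ell>\<close>-subgroups. Hahn's
  construction supplies such groups with prescribed spectrum: if the elements above any given point of
  a poset \<open>\<Delta>\<close> form a chain (a root system), then the finitely supported functions \<open>\<Delta> \<rightarrow> \<int>\<close>, ordered
  by the sign of their leading values, form a lattice-ordered group. A function \<open>f\<close> of its cone
  belongs to the ideal generated by \<open>g\<close> exactly if the down-set generated by the support of \<open>f\<close> is
  contained in that of \<open>g\<close>, because a higher leading value beats every multiple of a lower one. Hence the
  compact open subsets of the spectrum correspond to the finitely generated down-sets of \<open>\<Delta>\<close>
  (lemmas \<open>supported_bck_hahn_cone\<close> and \<open>lattice_isomorphic_compact_opens\<close>).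

  A lattice with least element in which every element is the join of finitely many join-prime
  elements is the lattice of finitely generated down-sets of its poset of join-primes. So such
  a lattice is realised as soon as the join-primes above a given one form a chain
  (\<open>prime_forest_lattice\<close>). This condition passes to finite products, whose poset of join-primes
  is the disjoint union of those of the factors (\<open>prime_forest_product_is_spectral\<close>), and
  it remains to check it for each kind of factor. In a chain, every element but the least is
  join-prime. In a finite distributive lattice, join-primes always generate, and only the chain
  condition is at stake: the poset of join-primes is isomorphic to that of meet-irreducibles, which
  settles trees; the join-primes of a Boolean lattice are incomparable atoms; and in a
  subdirectly irreducible distributive p-algebra, the only join-prime that can lie strictly above another
  is the top element.
\<close>

section \<open>Compact open sets of the spectrum from a support map\<close>

lemma bck_ideal_subset: "bck_ideal A I \<Longrightarrow> I \<subseteq> carrier A"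
  by (simp add: bck_ideal_def)

lemma bck_prime_ideal_is_ideal: "bck_prime_ideal A P \<Longrightarrow> bck_ideal A P"
  by (simp add: bck_prime_ideal_def)

text \<open>
  A support map sends each element to a set of points such that the ideals become visible: an ideal is
  determined by the union of the supports of its members, and every point \<open>p\<close> of a support yields the
  prime ideal of the elements whose support avoids \<open>p\<close>. These point primes suffice to
  separate an element from an ideal that does not contain it.
  The assumption \<open>support_generated\<close> is what makes the basic open sets compact.
\<close>

locale supported_bck = commutative_bck A for A :: "('b, 'm) bck_scheme" (structure) +
  fixes s :: "'b \<Rightarrow> 'i set"
  assumes support_zero: "s \<zero> = {}"
    and support_sub: "\<lbrakk>x \<in> carrier A; y \<in> carrier A\<rbrakk> \<Longrightarrow> s x \<subseteq> s (x \<cdot> y) \<union> s y"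
    and support_meet: "\<lbrakk>x \<in> carrier A; y \<in> carrier A\<rbrakk> \<Longrightarrow> s x \<inter> s y \<subseteq> s (bck_meet A x y)"
    and support_join: "\<lbrakk>x \<in> carrier A; y \<in> carrier A\<rbrakk> \<Longrightarrow> \<exists>z\<in>carrier A. s z = s x \<union> s y"
    and support_generated: "x \<in> carrier A \<Longrightarrow>
          \<exists>F\<subseteq>s x. finite F \<and> (\<forall>z\<in>carrier A. F \<subseteq> s z \<longrightarrow> s x \<subseteq> s z)"
    and ideal_absorbs: "\<lbrakk>bck_ideal A I; x \<in> I; y \<in> I; z \<in> carrier A; s z \<subseteq> s x \<union> s y\<rbrakk> \<Longrightarrow> z \<in> I"
begin

definition basic_open :: "'b \<Rightarrow> 'b set set" where
  "basic_open x = {P. bck_prime_ideal A P \<and> x \<notin> P}"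

lemma ideal_of_supports: "bck_ideal A {z \<in> carrier A. s z \<subseteq> Z}"
  unfolding bck_ideal_def using zero_closed support_zero support_sub by blast

lemma ideal_contains_join:
  assumes I: "bck_ideal A I" and "finite F" "F \<subseteq> I"
  shows "\<exists>z\<in>I. s z = (\<Union>y\<in>F. s y)"
  using assms(2,3)
proof (induction F rule: finite_induct)
  case empty
  then show ?case using I support_zero by (auto simp: bck_ideal_def)
next
  case (insert y F)
  then obtain z where z: "z \<in> I" "s z = (\<Union>y\<in>F. s y)" by auto
  have car: "y \<in> carrier A" "z \<in> carrier A"
    using z insert.prems bck_ideal_subset[OF I] by auto
  obtain w where w: "w \<in> carrier A" "s w = s y \<union> s z"
    using support_join[OF car] by blast
  have "w \<in> I"
    using ideal_absorbs[OF I _ z(1) w(1), of y] w(2) insert.prems by simp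
  then show ?case using w z by auto
qed

text \<open>
  Only finitely many points of the support of \<open>x\<close> have to be covered by members of the ideal, so
  finitely many members already generate \<open>x\<close>. This finiteness is the source of compactness.
\<close>

lemma mem_idealI:
  assumes I: "bck_ideal A I" and x: "x \<in> carrier A" and F: "finite F"
    and gen: "\<And>z. z \<in> carrier A \<Longrightarrow> F \<subseteq> s z \<Longrightarrow> s x \<subseteq> s z"
    and cov: "\<And>p. p \<in> F \<Longrightarrow> \<exists>y\<in>I. p \<in> s y"
  shows "x \<in> I"
proof -
  obtain y where y: "\<And>p. p \<in> F \<Longrightarrow> y p \<in> I \<and> p \<in> s (y p)"
    using cov by metis
  obtain z where z: "z \<in> I" "s z = (\<Union>v\<in>y ` F. s v)"
    using ideal_contains_join[OF I, of "y ` F"] F y by blast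
  have "s x \<subseteq> s z"
  proof (rule gen)
    show "z \<in> carrier A" using z bck_ideal_subset[OF I] by blast
    show "F \<subseteq> s z" using y z by auto
  qed
  then show ?thesis
    using ideal_absorbs[OF I z(1) z(1) x] by simp
qed

lemma prime_at_point:
  assumes "x \<in> carrier A" "p \<in> s x"
  shows "bck_prime_ideal A {z \<in> carrier A. p \<notin> s z}"
proof -
  have "{z \<in> carrier A. p \<notin> s z} = {z \<in> carrier A. s z \<subseteq> - {p}}" by auto
  then have "bck_ideal A {z \<in> carrier A. p \<notin> s z}"
    using ideal_of_supports[of "- {p}"] by simp
  then show ?thesis
    using assms support_meet unfolding bck_prime_ideal_def by blast
qed

lemma basic_subset_iff:
  assumes x: "x \<in> carrier A" and y: "y \<in> carrier A"
  shows "basic_open x \<subseteq> basic_open y \<longleftrightarrow> s x \<subseteq> s y"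
proof
  assume sub: "basic_open x \<subseteq> basic_open y"
  show "s x \<subseteq> s y"
  proof
    fix p assume "p \<in> s x"
    then have "{z \<in> carrier A. p \<notin> s z} \<in> basic_open x"
      using prime_at_point[OF x] x by (auto simp: basic_open_def)
    then have "{z \<in> carrier A. p \<notin> s z} \<in> basic_open y" using sub by blast
    then show "p \<in> s y" using y by (auto simp: basic_open_def)
  qed
next
  assume "s x \<subseteq> s y"
  then have "x \<in> P" if "bck_prime_ideal A P" "y \<in> P" for P
    using ideal_absorbs[of P y y x] that x bck_prime_ideal_is_ideal by blast
  then show "basic_open x \<subseteq> basic_open y"
    by (auto simp: basic_open_def)
qed

lemma basic_eq_sigma:
  assumes x: "x \<in> carrier A"
  shows "basic_open x = bck_sigma A {z \<in> carrier A. s z \<subseteq> s x}"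
proof -
  have "x \<in> P \<longleftrightarrow> {z \<in> carrier A. s z \<subseteq> s x} \<subseteq> P" if "bck_prime_ideal A P" for P
    using ideal_absorbs[of P x x] bck_prime_ideal_is_ideal[OF that] x by blast
  then show ?thesis by (auto simp: basic_open_def bck_sigma_def)
qed

lemma openin_basic: "x \<in> carrier A \<Longrightarrow> openin (bck_spectrum A) (basic_open x)"
  using openin_bck_spectrum basic_eq_sigma ideal_of_supports by blast

text \<open>
  The point primes at the finitely many points that generate the support of \<open>x\<close> select a
  finite subfamily of the cover. It covers everything, as a prime ideal missed by it would
  contain elements whose supports jointly cover these points, and therefore \<open>x\<close> itself.
\<close>

lemma compactin_basic:
  assumes x: "x \<in> carrier A"
  shows "compactin (bck_spectrum A) (basic_open x)"
  unfolding compactin_def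
proof (intro conjI allI impI)
  show "basic_open x \<subseteq> topspace (bck_spectrum A)"
    using openin_basic[OF x] by (rule openin_subset)
next
  fix \<U> assume U: "(\<forall>U\<in>\<U>. openin (bck_spectrum A) U) \<and> basic_open x \<subseteq> \<Union>\<U>"
  obtain F where F: "F \<subseteq> s x" "finite F"
    and gen: "\<And>z. z \<in> carrier A \<Longrightarrow> F \<subseteq> s z \<Longrightarrow> s x \<subseteq> s z"
    using support_generated[OF x] by blast
  have "\<exists>U\<in>\<U>. \<exists>y\<in>carrier A. p \<in> s y \<and> basic_open y \<subseteq> U" if p: "p \<in> F" for p
  proof -
    let ?P = "{z \<in> carrier A. p \<notin> s z}"
    have "?P \<in> basic_open x"
      using prime_at_point[OF x] p F x by (auto simp: basic_open_def)
    then obtain U where "U \<in> \<U>" "?P \<in> U" using U by blast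
    moreover obtain I where I: "bck_ideal A I" "U = bck_sigma A I"
      using U \<open>U \<in> \<U>\<close> openin_bck_spectrum by blast
    ultimately obtain y where "y \<in> I" "y \<notin> ?P" by (auto simp: bck_sigma_def)
    then show ?thesis
      using I \<open>U \<in> \<U>\<close> bck_ideal_subset[OF I(1)]
      by (intro bexI[of _ U] bexI[of _ y]) (auto simp: bck_sigma_def basic_open_def)
  qed
  then obtain V y where V: "\<And>p. p \<in> F \<Longrightarrow> V p \<in> \<U> \<and> y p \<in> carrier A \<and> p \<in> s (y p) \<and> basic_open (y p) \<subseteq> V p"
    by metis
  have "basic_open x \<subseteq> \<Union>(V ` F)"
  proof
    fix P assume P: "P \<in> basic_open x"
    have "\<exists>p\<in>F. y p \<notin> P"
    proof (rule ccontr)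
      assume "\<not> (\<exists>p\<in>F. y p \<notin> P)"
      then have "x \<in> P"
        using P V by (intro mem_idealI[OF _ x F(2) gen])
          (auto simp: basic_open_def intro: bck_prime_ideal_is_ideal)
      then show False using P by (simp add: basic_open_def)
    qed
    then show "P \<in> \<Union>(V ` F)"
      using P V by (fastforce simp: basic_open_def)
  qed
  then show "\<exists>\<F>. finite \<F> \<and> \<F> \<subseteq> \<U> \<and> basic_open x \<subseteq> \<Union>\<F>"
    using F V by (intro exI[of _ "V ` F"]) auto
qed

text \<open>
  An open set \<open>\<sigma>(I)\<close> is the union of the basic sets of the members of \<open>I\<close>. Compactness leaves
  finitely many of them, and their join in \<open>I\<close> defines the whole set.
\<close>

lemma compact_open_is_basic:
  assumes "openin (bck_spectrum A) U" "compactin (bck_spectrum A) U"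
  shows "\<exists>z\<in>carrier A. U = basic_open z"
proof -
  obtain I where I: "bck_ideal A I" "U = bck_sigma A I"
    using assms(1) openin_bck_spectrum by blast
  have car: "I \<subseteq> carrier A" using I bck_ideal_subset by blast
  have "U \<subseteq> \<Union>(basic_open ` I)"
    using I by (auto simp: bck_sigma_def basic_open_def)
  then obtain \<F> where F: "finite \<F>" "\<F> \<subseteq> basic_open ` I" "U \<subseteq> \<Union>\<F>"
    using compactinD[OF assms(2), of "basic_open ` I"] openin_basic car by blast
  then obtain G where G: "finite G" "G \<subseteq> I" "\<F> = basic_open ` G"
    using finite_subset_image by meson
  obtain z where z: "z \<in> I" "s z = (\<Union>y\<in>G. s y)"
    using ideal_contains_join[OF I(1) G(1,2)] by blast
  have "basic_open y \<subseteq> basic_open z" if "y \<in> G" for y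
    using basic_subset_iff z G car that by blast
  then have "U \<subseteq> basic_open z" using F G by blast
  moreover have "basic_open z \<subseteq> U"
    using z I by (auto simp: bck_sigma_def basic_open_def)
  ultimately show ?thesis using z car by blast
qed

lemma carrier_compact_open_lattice:
  "carrier (compact_open_lattice A) = basic_open ` carrier A"
  using compact_open_is_basic openin_basic compactin_basic
  by (auto simp: compact_open_lattice_def)

end

lemma (in lattice) lattice_isomorphicI:
  assumes M: "partial_order M" and bij: "bij_betw f (carrier L) (carrier M)"
    and le: "\<And>x y. \<lbrakk>x \<in> carrier L; y \<in> carrier L\<rbrakk> \<Longrightarrow> f x \<sqsubseteq>\<^bsub>M\<^esub> f y \<longleftrightarrow> x \<sqsubseteq> y"
  shows "lattice_isomorphic L M"
proof -
  interpret M: partial_order M by (rule M)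
  have img: "f ` carrier L = carrier M" using bij by (simp add: bij_betw_def)
  have lub: "least M (f (x \<squnion> y)) (Upper M {f x, f y})" if that': "x \<in> carrier L" "y \<in> carrier L" for x y
  proof (rule least_UpperI)
    show "f (x \<squnion> y) \<in> carrier M" "{f x, f y} \<subseteq> carrier M" using img that' by auto
    show "a \<sqsubseteq>\<^bsub>M\<^esub> f (x \<squnion> y)" if "a \<in> {f x, f y}" for a
      using that le \<open>x \<in> carrier L\<close> \<open>y \<in> carrier L\<close> join_left join_right by auto
    show "f (x \<squnion> y) \<sqsubseteq>\<^bsub>M\<^esub> b" if "b \<in> Upper M {f x, f y}" for b
    proof -
      obtain z where z: "z \<in> carrier L" "b = f z" using img \<open>b \<in> _\<close> unfolding Upper_def by blast
      have xy: "f x \<in> carrier M" "f y \<in> carrier M" using img that' by auto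
      then have "f x \<sqsubseteq>\<^bsub>M\<^esub> f z" "f y \<sqsubseteq>\<^bsub>M\<^esub> f z"
        using that z unfolding Upper_def by blast+
      then show ?thesis using le z that' by (simp add: join_le)
    qed
  qed
  have glb: "greatest M (f (x \<sqinter> y)) (Lower M {f x, f y})" if that': "x \<in> carrier L" "y \<in> carrier L" for x y
  proof (rule greatest_LowerI)
    show "f (x \<sqinter> y) \<in> carrier M" "{f x, f y} \<subseteq> carrier M" using img that' by auto
    show "f (x \<sqinter> y) \<sqsubseteq>\<^bsub>M\<^esub> a" if "a \<in> {f x, f y}" for a
      using that le \<open>x \<in> carrier L\<close> \<open>y \<in> carrier L\<close> meet_left meet_right by auto
    show "b \<sqsubseteq>\<^bsub>M\<^esub> f (x \<sqinter> y)" if "b \<in> Lower M {f x, f y}" for b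
    proof -
      obtain z where z: "z \<in> carrier L" "b = f z" using img \<open>b \<in> _\<close> unfolding Lower_def by blast
      have xy: "f x \<in> carrier M" "f y \<in> carrier M" using img that' by auto
      then have "f z \<sqsubseteq>\<^bsub>M\<^esub> f x" "f z \<sqsubseteq>\<^bsub>M\<^esub> f y"
        using that z unfolding Lower_def by blast+
      then show ?thesis using le z that' by (simp add: meet_le)
    qed
  qed
  interpret M: lattice M
  proof
    fix u v assume "u \<in> carrier M" "v \<in> carrier M"
    then obtain x y where "x \<in> carrier L" "y \<in> carrier L" "u = f x" "v = f y"
      using img by blast
    then show "\<exists>s. least M s (Upper M {u, v})" "\<exists>s. greatest M s (Lower M {u, v})"
      using lub glb by blast+
  qed
  have "f (x \<squnion> y) = f x \<squnion>\<^bsub>M\<^esub> f y" if "x \<in> carrier L" "y \<in> carrier L" for x y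
    using M.joinI[of "f x" "f y" "\<lambda>l. f (x \<squnion> y) = l"] M.least_unique lub that img by blast
  moreover have "f (x \<sqinter> y) = f x \<sqinter>\<^bsub>M\<^esub> f y" if "x \<in> carrier L" "y \<in> carrier L" for x y
    using M.meetI[of "f x" "f y" "\<lambda>l. f (x \<sqinter> y) = l"] M.greatest_unique glb that img by blast
  ultimately show ?thesis
    using bij M.lattice_axioms lattice_axioms
    unfolding lattice_isomorphic_def join_pres_def meet_pres_def by blast
qed

lemma partial_order_inclusion:
  "partial_order \<lparr>carrier = X, eq = (=), le = (\<subseteq>)\<rparr>"
  by unfold_locales auto

text \<open>
  An element \<open>a\<close> of the lattice is sent to the basic open set of any algebra element with support
  \<open>h a\<close>; the choice is immaterial because inclusion of basic sets is inclusion of supports.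
\<close>

lemma (in supported_bck) lattice_isomorphic_compact_opens:
  assumes L: "lattice L" and h: "h ` carrier L = s ` carrier A"
    and le: "\<And>a b. \<lbrakk>a \<in> carrier L; b \<in> carrier L\<rbrakk> \<Longrightarrow> h a \<subseteq> h b \<longleftrightarrow> a \<sqsubseteq>\<^bsub>L\<^esub> b"
  shows "lattice_isomorphic L (compact_open_lattice A)"
proof -
  interpret L: lattice L by (rule L)
  have "\<forall>a\<in>carrier L. \<exists>x\<in>carrier A. s x = h a"
    using h by (metis imageE imageI)
  then obtain g where g: "\<And>a. a \<in> carrier L \<Longrightarrow> g a \<in> carrier A \<and> s (g a) = h a"
    by metis
  have sub: "basic_open (g a) \<subseteq> basic_open (g b) \<longleftrightarrow> a \<sqsubseteq>\<^bsub>L\<^esub> b"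
    if "a \<in> carrier L" "b \<in> carrier L" for a b
    using basic_subset_iff g le that by simp
  show ?thesis
  proof (rule L.lattice_isomorphicI)
    show "partial_order (compact_open_lattice A)"
      unfolding compact_open_lattice_def by (rule partial_order_inclusion)
    show "bij_betw (\<lambda>a. basic_open (g a)) (carrier L) (carrier (compact_open_lattice A))"
      unfolding bij_betw_def carrier_compact_open_lattice
    proof (intro conjI inj_onI subset_antisym subsetI)
      fix a b assume "a \<in> carrier L" "b \<in> carrier L" "basic_open (g a) = basic_open (g b)"
      then show "a = b" using sub[of a b] sub[of b a] L.le_antisym by auto
    next
      fix U assume "U \<in> basic_open ` carrier A"
      then obtain x where x: "x \<in> carrier A" "U = basic_open x" by blast
      then obtain a where a: "a \<in> carrier L" "s x = h a" using h by (metis imageE imageI)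
      then have "U = basic_open (g a)"
        using basic_subset_iff[of x "g a"] basic_subset_iff[of "g a" x] g x by auto
      then show "U \<in> (\<lambda>a. basic_open (g a)) ` carrier L" using a by blast
    qed (use g in auto)
    show "basic_open (g a) \<sqsubseteq>\<^bsub>compact_open_lattice A\<^esub> basic_open (g b) \<longleftrightarrow> a \<sqsubseteq>\<^bsub>L\<^esub> b"
      if "a \<in> carrier L" "b \<in> carrier L" for a b
      using sub[OF that] by (simp add: compact_open_lattice_def)
  qed
qed

section \<open>The cone of a Hahn group over a root system\<close>

text \<open>
  The order is kept as a predicate relativised to \<open>\<Delta>\<close>, because the root systems that are needed
  here are sets of pairs, carved out of a type that has no suitable order of its own.
\<close>

locale root_system =
  fixes \<Delta> :: "'i set" and ord :: "'i \<Rightarrow> 'i \<Rightarrow> bool"  (infix \<open>\<preceq>\<close> 50)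
  assumes ord_refl: "a \<in> \<Delta> \<Longrightarrow> a \<preceq> a"
    and ord_antisym: "\<lbrakk>a \<in> \<Delta>; b \<in> \<Delta>; a \<preceq> b; b \<preceq> a\<rbrakk> \<Longrightarrow> a = b"
    and ord_trans: "\<lbrakk>a \<in> \<Delta>; b \<in> \<Delta>; c \<in> \<Delta>; a \<preceq> b; b \<preceq> c\<rbrakk> \<Longrightarrow> a \<preceq> c"
    and above_chain: "\<lbrakk>a \<in> \<Delta>; b \<in> \<Delta>; c \<in> \<Delta>; a \<preceq> b; a \<preceq> c\<rbrakk> \<Longrightarrow> b \<preceq> c \<or> c \<preceq> b"
begin

text \<open>
  The restriction of a finitely supported function to the chain above \<open>\<delta>\<close> lies in a lexicographic sum of
  copies of the integers, a totally ordered group, and \<open>positive_at \<delta> h\<close> says that \<open>h\<close> is positive there: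
  its value at its topmost nonzero point is positive. The Hahn group embeds into the product of
  these groups over all \<open>\<delta>\<close>. Identities can therefore be checked one \<open>\<delta>\<close> at a time, where truncated
  subtraction is that of a totally ordered group.
\<close>

definition positive_at :: "'i \<Rightarrow> ('i \<Rightarrow> int) \<Rightarrow> bool" where
  "positive_at \<delta> h \<longleftrightarrow> (\<exists>m\<in>\<Delta>. \<delta> \<preceq> m \<and> 0 < h m \<and> (\<forall>k\<in>\<Delta>. m \<preceq> k \<and> k \<noteq> m \<longrightarrow> h k = 0))"

definition agree :: "'i \<Rightarrow> ('i \<Rightarrow> int) \<Rightarrow> ('i \<Rightarrow> int) \<Rightarrow> bool" where
  "agree \<delta> f g \<longleftrightarrow> (\<forall>k\<in>\<Delta>. \<delta> \<preceq> k \<longrightarrow> f k = g k)"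

definition positive_part :: "('i \<Rightarrow> int) \<Rightarrow> 'i \<Rightarrow> int" where
  "positive_part h \<delta> = (if \<delta> \<in> \<Delta> \<and> positive_at \<delta> h then h \<delta> else 0)"

definition cone :: "('i \<Rightarrow> int) set" where
  "cone = {f. finite {k. f k \<noteq> 0} \<and> {k. f k \<noteq> 0} \<subseteq> \<Delta> \<and> (\<forall>\<delta>\<in>\<Delta>. \<not> positive_at \<delta> (- f))}"

definition hahn_cone :: "('i \<Rightarrow> int) bck" where
  "hahn_cone = \<lparr>carrier = cone, bck_sub = (\<lambda>x y. positive_part (x - y)), bck_zero = 0\<rparr>"

definition shadow :: "('i \<Rightarrow> int) \<Rightarrow> 'i set" where
  "shadow f = {\<delta> \<in> \<Delta>. \<exists>k\<in>\<Delta>. \<delta> \<preceq> k \<and> f k \<noteq> 0}"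

lemma agree_sym: "agree \<delta> f g \<Longrightarrow> agree \<delta> g f"
  by (simp add: agree_def)

lemma agree_at: "\<lbrakk>\<delta> \<in> \<Delta>; agree \<delta> f g\<rbrakk> \<Longrightarrow> f \<delta> = g \<delta>"
  by (simp add: agree_def ord_refl)

lemma agree_diff: "\<lbrakk>agree \<delta> f f'; agree \<delta> g g'\<rbrakk> \<Longrightarrow> agree \<delta> (f - g) (f' - g')"
  by (simp add: agree_def)

lemma agree_refl: "agree \<delta> f f"
  by (simp add: agree_def)

lemma agree_up: "\<lbrakk>\<delta> \<in> \<Delta>; k \<in> \<Delta>; \<delta> \<preceq> k; agree \<delta> f g\<rbrakk> \<Longrightarrow> agree k f g"
  unfolding agree_def using ord_trans[of \<delta> k] by simp

lemma positive_at_cong: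
  assumes "\<delta> \<in> \<Delta>" "agree \<delta> f g"
  shows "positive_at \<delta> f \<longleftrightarrow> positive_at \<delta> g"
proof -
  have "positive_at \<delta> g" if ag: "agree \<delta> f g" and pos: "positive_at \<delta> f" for f g
  proof -
    obtain m where m: "m \<in> \<Delta>" "\<delta> \<preceq> m" "0 < f m" "\<And>k. k \<in> \<Delta> \<Longrightarrow> m \<preceq> k \<Longrightarrow> k \<noteq> m \<Longrightarrow> f k = 0"
      using pos unfolding positive_at_def by blast
    have eq: "f k = g k" if "k \<in> \<Delta>" "m \<preceq> k" for k
      using ord_trans[OF assms(1) m(1) that(1) m(2) that(2)] ag that
      by (simp add: agree_def)
    have "0 < g m" using m(3) eq[OF m(1) ord_refl[OF m(1)]] by simp
    moreover have "g k = 0" if "k \<in> \<Delta>" "m \<preceq> k" "k \<noteq> m" for k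
      using m(4)[OF that] eq[OF that(1,2)] by simp
    ultimately show ?thesis
      unfolding positive_at_def using m(1,2) by blast
  qed
  then show ?thesis using assms(2) agree_sym by blast
qed

lemma not_positive_at_zero: "\<not> positive_at \<delta> 0"
  by (simp add: positive_at_def)

text \<open>
  The higher of the two topmost points decides; they are comparable since both lie above \<open>\<delta>\<close>.
\<close>

lemma positive_at_add:
  assumes d: "\<delta> \<in> \<Delta>" and f: "positive_at \<delta> f" and g: "positive_at \<delta> g"
  shows "positive_at \<delta> (f + g)"
proof -
  have *: "positive_at \<delta> (f + g)"
    if m: "m \<in> \<Delta>" "\<delta> \<preceq> m" "0 < f m" "\<And>k. k \<in> \<Delta> \<Longrightarrow> m \<preceq> k \<Longrightarrow> k \<noteq> m \<Longrightarrow> f k = 0"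
      and n: "n \<in> \<Delta>" "\<delta> \<preceq> n" "0 < g n" "\<And>k. k \<in> \<Delta> \<Longrightarrow> n \<preceq> k \<Longrightarrow> k \<noteq> n \<Longrightarrow> g k = 0"
      and le: "m \<preceq> n" for f g m n
  proof -
    have "0 < (f + g) n"
      using m n le by (cases "m = n") auto
    moreover have "(f + g) k = 0" if k: "k \<in> \<Delta>" "n \<preceq> k" "k \<noteq> n" for k
    proof -
      have "m \<preceq> k" using ord_trans[OF m(1) n(1) k(1) le k(2)] .
      moreover have "k \<noteq> m" using ord_antisym[OF m(1) n(1) le] k by blast
      ultimately show ?thesis using m(4) n(4) k by simp
    qed
    ultimately show ?thesis
      unfolding positive_at_def using n by blast
  qed
  obtain m where m: "m \<in> \<Delta>" "\<delta> \<preceq> m" "0 < f m" "\<And>k. k \<in> \<Delta> \<Longrightarrow> m \<preceq> k \<Longrightarrow> k \<noteq> m \<Longrightarrow> f k = 0"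
    using f unfolding positive_at_def by blast
  obtain n where n: "n \<in> \<Delta>" "\<delta> \<preceq> n" "0 < g n" "\<And>k. k \<in> \<Delta> \<Longrightarrow> n \<preceq> k \<Longrightarrow> k \<noteq> n \<Longrightarrow> g k = 0"
    using g unfolding positive_at_def by blast
  from above_chain[OF d m(1) n(1) m(2) n(2)] show ?thesis
  proof
    assume "m \<preceq> n"
    then show ?thesis by (intro *[of m f n g] m n)
  next
    assume "n \<preceq> m"
    then have "positive_at \<delta> (g + f)" by (intro *[of n g m f] m n)
    then show ?thesis by (simp add: add.commute)
  qed
qed

lemma positive_at_trichotomy:
  assumes d: "\<delta> \<in> \<Delta>" and fin: "finite {k. f k \<noteq> 0}"
  shows "positive_at \<delta> f \<or> positive_at \<delta> (- f) \<or> agree \<delta> f 0"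
proof (cases "agree \<delta> f 0")
  case False
  let ?S = "{k \<in> \<Delta>. \<delta> \<preceq> k \<and> f k \<noteq> 0}"
  let ?R = "\<lambda>a b. a \<preceq> b \<and> a \<noteq> b"
  have "finite ?S" using fin by simp
  moreover have "?S \<noteq> {}" using False by (auto simp: agree_def)
  moreover have "asymp_on ?S ?R" using ord_antisym by (auto simp: asymp_on_def)
  moreover have "transp_on ?S ?R"
  proof (rule transp_onI)
    fix a b c assume abc: "a \<in> ?S" "b \<in> ?S" "c \<in> ?S" "?R a b" "?R b c"
    then have "a \<preceq> c" using ord_trans[of a b c] by simp
    moreover have "a \<noteq> c" using ord_antisym[of a b] abc by auto
    ultimately show "?R a c" by simp
  qed
  ultimately obtain m where m: "m \<in> ?S" "\<And>k. k \<in> ?S \<Longrightarrow> k \<noteq> m \<Longrightarrow> \<not> ?R m k"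
    using Finite_Set.bex_max_element[of ?S ?R] by blast
  have zero: "f k = 0" if k: "k \<in> \<Delta>" "m \<preceq> k" "k \<noteq> m" for k
  proof -
    have "\<delta> \<preceq> k" using ord_trans[of \<delta> m k] m(1) d k by simp
    then show ?thesis using m(2)[of k] k by auto
  qed
  have "0 < f m \<or> 0 < (- f) m" using m(1) by auto
  then show ?thesis
    unfolding positive_at_def using m(1) zero by auto
qed simp

lemma not_positive_both:
  assumes "\<delta> \<in> \<Delta>" "positive_at \<delta> f"
  shows "\<not> positive_at \<delta> (- f)"
  using positive_at_add[OF assms, of "- f"] not_positive_at_zero by auto

text \<open>
  \<open>positive_part\<close> is defined pointwise by a sign that depends on the point. On the whole chain
  above \<open>\<delta>\<close> it is nevertheless either the identity or zero: above the topmost nonzero point the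
  function vanishes anyway, and at all points below it the sign is the same.
\<close>

lemma positive_part_agree_pos:
  assumes d: "\<delta> \<in> \<Delta>" and f: "positive_at \<delta> f"
  shows "agree \<delta> (positive_part f) f"
  unfolding agree_def
proof (intro ballI impI)
  fix k assume k: "k \<in> \<Delta>" "\<delta> \<preceq> k"
  obtain m where m: "m \<in> \<Delta>" "\<delta> \<preceq> m" "0 < f m" "\<And>k. k \<in> \<Delta> \<Longrightarrow> m \<preceq> k \<Longrightarrow> k \<noteq> m \<Longrightarrow> f k = 0"
    using f unfolding positive_at_def by blast
  have "k \<preceq> m \<or> f k = 0"
    using above_chain[OF d m(1) k(1) m(2) k(2)] m(4)[of k] k by blast
  moreover have "positive_at k f" if "k \<preceq> m"
    using m that unfolding positive_at_def by blast
  ultimately show "positive_part f k = f k"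
    using k by (auto simp: positive_part_def)
qed

lemma positive_part_agree_zero:
  assumes d: "\<delta> \<in> \<Delta>" and f: "\<not> positive_at \<delta> f"
  shows "agree \<delta> (positive_part f) 0"
proof -
  have "\<not> positive_at k f" if "k \<in> \<Delta>" "\<delta> \<preceq> k" for k
  proof
    assume "positive_at k f"
    then obtain m where m: "m \<in> \<Delta>" "k \<preceq> m" "0 < f m" "\<forall>k\<in>\<Delta>. m \<preceq> k \<and> k \<noteq> m \<longrightarrow> f k = 0"
      unfolding positive_at_def by blast
    then have "\<delta> \<preceq> m" using ord_trans[OF d that(1) m(1) that(2)] by simp
    then show False using f m unfolding positive_at_def by blast
  qed
  then show ?thesis by (auto simp: agree_def positive_part_def)
qed

lemma positive_part_cong:
  assumes "\<delta> \<in> \<Delta>" "agree \<delta> f g"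
  shows "agree \<delta> (positive_part f) (positive_part g)"
  using assms positive_at_cong[OF _ agree_up[OF assms(1) _ _ assms(2)]]
  by (auto simp: agree_def positive_part_def)

lemma cone_finite: "x \<in> cone \<Longrightarrow> finite {k. x k \<noteq> 0}"
  by (simp add: cone_def)

lemma cone_outside: "x \<in> cone \<Longrightarrow> k \<notin> \<Delta> \<Longrightarrow> x k = 0"
  by (auto simp: cone_def)

lemma cone_not_negative: "\<lbrakk>x \<in> cone; \<delta> \<in> \<Delta>\<rbrakk> \<Longrightarrow> \<not> positive_at \<delta> (- x)"
  by (simp add: cone_def)

lemma cone_cases:
  assumes "x \<in> cone" "\<delta> \<in> \<Delta>"
  obtains "positive_at \<delta> x" | "agree \<delta> x 0"
  using assms positive_at_trichotomy[of \<delta> x] cone_finite cone_not_negative by blast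

lemma eqI_on_index:
  assumes "\<And>\<delta>. \<delta> \<in> \<Delta> \<Longrightarrow> f \<delta> = g \<delta>" "\<And>\<delta>. \<delta> \<notin> \<Delta> \<Longrightarrow> f \<delta> = 0" "\<And>\<delta>. \<delta> \<notin> \<Delta> \<Longrightarrow> g \<delta> = 0"
  shows "f = g"
  using assms by (metis ext)

lemma positive_part_outside: "\<delta> \<notin> \<Delta> \<Longrightarrow> positive_part f \<delta> = 0"
  by (simp add: positive_part_def)

lemma finite_support_diff:
  fixes x y :: "'i \<Rightarrow> int"
  assumes "finite {k. x k \<noteq> 0}" "finite {k. y k \<noteq> 0}"
  shows "finite {k. (x - y) k \<noteq> 0}"
  by (rule finite_subset[OF _ finite_UnI[OF assms]]) auto

lemma positive_part_in_cone:
  assumes fin: "finite {k. f k \<noteq> 0}"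
  shows "positive_part f \<in> cone"
proof -
  have "finite {k. positive_part f k \<noteq> 0}"
    by (rule finite_subset[OF _ fin]) (auto simp: positive_part_def)
  moreover have "{k. positive_part f k \<noteq> 0} \<subseteq> \<Delta>"
    by (auto simp: positive_part_def)
  moreover have "\<not> positive_at \<delta> (- positive_part f)" if d: "\<delta> \<in> \<Delta>" for \<delta>
  proof (cases "positive_at \<delta> f")
    case True
    then have "agree \<delta> (- positive_part f) (- f)"
      using positive_part_agree_pos[OF d] by (simp add: agree_def)
    then show ?thesis
      using positive_at_cong[OF d] not_positive_both[OF d True] by blast
  next
    case False
    then have "agree \<delta> (- positive_part f) 0"
      using positive_part_agree_zero[OF d] by (simp add: agree_def)
    then show ?thesis
      using positive_at_cong[OF d] not_positive_at_zero by blast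
  qed
  ultimately show ?thesis by (simp add: cone_def)
qed

lemma positive_part_cone:
  assumes "x \<in> cone"
  shows "positive_part x = x"
proof (rule eqI_on_index)
  fix \<delta> assume d: "\<delta> \<in> \<Delta>"
  show "positive_part x \<delta> = x \<delta>"
    using cone_cases[OF assms d] agree_at[OF d, of x 0] d by (auto simp: positive_part_def)
qed (use assms in \<open>simp_all add: positive_part_outside cone_outside\<close>)

text \<open>
  For nonnegative \<open>z\<close>, truncating before subtracting \<open>z\<close> makes no difference after the final
  truncation. Hence \<open>(x \<cdot> y) \<cdot> z\<close> is the positive part of \<open>x - y - z\<close>, which is symmetric in \<open>y\<close> and \<open>z\<close>.
\<close>

lemma positive_part_diff:
  assumes z: "z \<in> cone"
  shows "positive_part (positive_part h - z) = positive_part (h - z)"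
proof (rule eqI_on_index)
  fix \<delta> assume d: "\<delta> \<in> \<Delta>"
  show "positive_part (positive_part h - z) \<delta> = positive_part (h - z) \<delta>"
  proof (cases "positive_at \<delta> h")
    case True
    show ?thesis
      using agree_at[OF d positive_part_cong[OF d agree_diff[OF positive_part_agree_pos[OF d True] agree_refl]]] .
  next
    case False
    have "agree \<delta> (positive_part h - z) (- z)"
      using positive_part_agree_zero[OF d False] by (simp add: agree_def)
    then have 1: "\<not> positive_at \<delta> (positive_part h - z)"
      using positive_at_cong[OF d] cone_not_negative[OF z d] by blast
    have 2: "\<not> positive_at \<delta> (h - z)"
    proof
      assume a: "positive_at \<delta> (h - z)"
      from z d show False
      proof (cases rule: cone_cases)
        case 1
        then show False using positive_at_add[OF d a 1] False by simp
      next
        case 2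
        then have "agree \<delta> (h - z) h" by (simp add: agree_def)
        then show False using positive_at_cong[OF d] a False by blast
      qed
    qed
    show ?thesis using 1 2 by (simp add: positive_part_def)
  qed
qed (simp_all add: positive_part_outside)

text \<open>
  In the totally ordered group at \<open>\<delta>\<close>, the BCK meet is the smaller of the two elements.
\<close>

lemma meet_agree:
  assumes x: "x \<in> cone" and y: "y \<in> cone" and d: "\<delta> \<in> \<Delta>"
  shows "agree \<delta> (positive_part (y - positive_part (y - x))) (if positive_at \<delta> (y - x) then x else y)"
proof -
  have "agree \<delta> (y - positive_part (y - x)) (if positive_at \<delta> (y - x) then x else y)"
    using positive_part_agree_pos[OF d] positive_part_agree_zero[OF d]
    by (auto simp: agree_def)
  from positive_part_cong[OF d this] show ?thesis
    using positive_part_cone x y by simp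
qed

lemma meet_commute:
  assumes x: "x \<in> cone" and y: "y \<in> cone"
  shows "positive_part (x - positive_part (x - y)) = positive_part (y - positive_part (y - x))"
proof (rule eqI_on_index)
  fix \<delta> assume d: "\<delta> \<in> \<Delta>"
  have "positive_at \<delta> (x - y) \<or> positive_at \<delta> (y - x) \<or> x \<delta> = y \<delta>"
    using positive_at_trichotomy[of \<delta> "x - y", OF d finite_support_diff[OF cone_finite[OF x] cone_finite[OF y]]]
      agree_at[OF d, of "x - y" 0] by auto
  moreover have "\<not> (positive_at \<delta> (x - y) \<and> positive_at \<delta> (y - x))"
    using not_positive_both[OF d, of "x - y"] by auto
  ultimately show "positive_part (x - positive_part (x - y)) \<delta> = positive_part (y - positive_part (y - x)) \<delta>"
    using agree_at[OF d meet_agree[OF x y d]] agree_at[OF d meet_agree[OF y x d]] by auto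
qed (simp_all add: positive_part_outside)

lemma zero_in_cone: "0 \<in> cone"
  by (simp add: cone_def not_positive_at_zero)

lemma commutative_bck_hahn_cone: "commutative_bck hahn_cone"
proof (unfold_locales, unfold hahn_cone_def, simp_all only: partial_object.simps bck.simps)
  show "positive_part (x - y) \<in> cone" if "x \<in> cone" "y \<in> cone" for x y
    using that by (intro positive_part_in_cone finite_support_diff cone_finite)
  show "positive_part (positive_part (x - y) - z) = positive_part (positive_part (x - z) - y)"
    if "x \<in> cone" "y \<in> cone" "z \<in> cone" for x y z
  proof -
    have "x - y - z = x - z - y" by simp
    then show ?thesis using positive_part_diff that by metis
  qed
  show "positive_part (x - x) = 0" for x
    by (auto simp: positive_part_def not_positive_at_zero)
qed (simp_all add: zero_in_cone meet_commute positive_part_cone)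

lemma add_in_cone:
  assumes x: "x \<in> cone" and y: "y \<in> cone"
  shows "x + y \<in> cone"
proof -
  have "finite {k. (x + y) k \<noteq> 0}"
    by (rule finite_subset[OF _ finite_UnI[OF cone_finite[OF x] cone_finite[OF y]]]) auto
  moreover have "{k. (x + y) k \<noteq> 0} \<subseteq> \<Delta>"
    using cone_outside[OF x] cone_outside[OF y] by force
  moreover have "\<not> positive_at \<delta> (- (x + y))" if d: "\<delta> \<in> \<Delta>" for \<delta>
    using x d
  proof (cases rule: cone_cases)
    case 1
    then show ?thesis
      using positive_at_add[OF d 1, of "- (x + y)"] cone_not_negative[OF y d] by auto
  next
    case 2
    then have "agree \<delta> (- (x + y)) (- y)" by (simp add: agree_def)
    then show ?thesis
      using positive_at_cong[OF d] cone_not_negative[OF y d] by blast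
  qed
  ultimately show ?thesis by (simp add: cone_def)
qed

lemma mem_shadow_iff:
  assumes "x \<in> cone"
  shows "\<delta> \<in> shadow x \<longleftrightarrow> \<delta> \<in> \<Delta> \<and> positive_at \<delta> x"
proof
  assume "\<delta> \<in> shadow x"
  then have d: "\<delta> \<in> \<Delta>" and "\<not> agree \<delta> x 0" by (auto simp: shadow_def agree_def)
  then show "\<delta> \<in> \<Delta> \<and> positive_at \<delta> x" using cone_cases[OF assms d] by blast
next
  assume "\<delta> \<in> \<Delta> \<and> positive_at \<delta> x"
  then show "\<delta> \<in> shadow x" by (fastforce simp: shadow_def positive_at_def)
qed

lemma shadow_add:
  assumes x: "x \<in> cone" and y: "y \<in> cone"
  shows "shadow (x + y) = shadow x \<union> shadow y"
proof
  show "shadow (x + y) \<subseteq> shadow x \<union> shadow y" by (auto simp: shadow_def)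
  have *: "shadow u \<subseteq> shadow (u + v)" if u: "u \<in> cone" and v: "v \<in> cone" for u v
  proof
    fix \<delta> assume "\<delta> \<in> shadow u"
    then have d: "\<delta> \<in> \<Delta>" and p: "positive_at \<delta> u" using mem_shadow_iff[OF u] by auto
    from v d have "positive_at \<delta> (u + v)"
    proof (cases rule: cone_cases)
      case 1
      then show ?thesis using positive_at_add[OF d p] by blast
    next
      case 2
      then have "agree \<delta> (u + v) u" by (simp add: agree_def)
      then show ?thesis using positive_at_cong[OF d] p by blast
    qed
    then show "\<delta> \<in> shadow (u + v)" using mem_shadow_iff[OF add_in_cone[OF u v]] d by blast
  qed
  show "shadow x \<union> shadow y \<subseteq> shadow (x + y)"
    using *[OF x y] *[OF y x] by (simp add: add.commute)
qed

lemma ideal_add: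
  assumes I: "bck_ideal hahn_cone I" and x: "x \<in> I" and y: "y \<in> I"
  shows "x + y \<in> I"
proof -
  have c: "x \<in> cone" "y \<in> cone" using bck_ideal_subset[OF I] x y by (auto simp: hahn_cone_def)
  have "positive_part ((x + y) - x) \<in> I" using y positive_part_cone[OF c(2)] by simp
  then show ?thesis
    using I x c add_in_cone[OF c] unfolding bck_ideal_def hahn_cone_def partial_object.simps bck.simps by blast
qed

lemma ideal_multiple:
  assumes I: "bck_ideal hahn_cone I" and x: "x \<in> I"
  shows "(\<lambda>k. int n * x k) \<in> I"
proof (induction n)
  case 0
  have "(\<lambda>k. int 0 * x k) = 0" by auto
  then show ?case using I by (simp add: bck_ideal_def hahn_cone_def)
next
  case (Suc n)
  have "(\<lambda>k. int (Suc n) * x k) = (\<lambda>k. int n * x k) + x"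
    by (auto simp: algebra_simps)
  then show ?case using ideal_add[OF I Suc x] by simp
qed

text \<open>
  At or above every point where \<open>z\<close> has its leading value there is a point where \<open>w\<close> has its leading
  value. So a multiple \<open>v\<close> of \<open>w\<close> by a factor above all values of \<open>z\<close> dominates \<open>z\<close>, and
  \<open>z \<cdot> v = 0\<close> puts \<open>z\<close> into the ideal.
\<close>

lemma ideal_absorbs_shadow:
  assumes I: "bck_ideal hahn_cone I" and w: "w \<in> I" and z: "z \<in> cone"
    and sub: "shadow z \<subseteq> shadow w"
  shows "z \<in> I"
proof -
  have wc: "w \<in> cone" using bck_ideal_subset[OF I] w by (auto simp: hahn_cone_def)
  define N where "N = nat (1 + (\<Sum>k | z k \<noteq> 0. \<bar>z k\<bar>))"
  define v where "v = (\<lambda>k. int N * w k)"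
  have v: "v \<in> I" unfolding v_def using ideal_multiple[OF I w] .
  have vc: "v \<in> cone" using bck_ideal_subset[OF I] v by (auto simp: hahn_cone_def)
  have nonneg: "0 \<le> (\<Sum>k | z k \<noteq> 0. \<bar>z k\<bar>)" by (intro sum_nonneg) simp
  then have N: "int N = 1 + (\<Sum>k | z k \<noteq> 0. \<bar>z k\<bar>)"
    unfolding N_def by simp
  have bound: "z k < int N" for k
  proof (cases "z k = 0")
    case False
    then have "\<bar>z k\<bar> \<le> (\<Sum>k | z k \<noteq> 0. \<bar>z k\<bar>)"
      using cone_finite[OF z] by (intro member_le_sum) auto
    then show ?thesis using N by linarith
  qed (use N nonneg in linarith)
  have "\<not> positive_at \<delta> (z - v)" if d: "\<delta> \<in> \<Delta>" for \<delta>
    using z d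
  proof (cases rule: cone_cases)
    case 1
    then obtain m where m: "m \<in> \<Delta>" "\<delta> \<preceq> m" "0 < z m" "\<And>k. k \<in> \<Delta> \<Longrightarrow> m \<preceq> k \<Longrightarrow> k \<noteq> m \<Longrightarrow> z k = 0"
      unfolding positive_at_def by blast
    have "m \<in> shadow z" using m ord_refl by (force simp: shadow_def)
    then have "positive_at m w" using sub mem_shadow_iff[OF wc] by blast
    then obtain n where n: "n \<in> \<Delta>" "m \<preceq> n" "0 < w n" "\<And>k. k \<in> \<Delta> \<Longrightarrow> n \<preceq> k \<Longrightarrow> k \<noteq> n \<Longrightarrow> w k = 0"
      unfolding positive_at_def by blast
    have "int N * 1 \<le> int N * w n" using n(3) by (intro mult_left_mono) auto
    then have "0 < (v - z) n" using bound[of n] by (simp add: v_def)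
    moreover have "(v - z) k = 0" if k: "k \<in> \<Delta>" "n \<preceq> k" "k \<noteq> n" for k
    proof -
      have "m \<preceq> k" using ord_trans[OF m(1) n(1) k(1) n(2) k(2)] .
      moreover have "k \<noteq> m" using ord_antisym[OF m(1) n(1) n(2)] k by blast
      ultimately show ?thesis using m(4) n(4) k by (simp add: v_def)
    qed
    ultimately have "positive_at \<delta> (v - z)"
      unfolding positive_at_def using n ord_trans[OF d m(1) n(1) m(2) n(2)] by blast
    then show ?thesis using not_positive_both[OF d] by (metis minus_diff_eq)
  next
    case 2
    then have "agree \<delta> (z - v) (- v)" by (simp add: agree_def)
    then show ?thesis using positive_at_cong[OF d] cone_not_negative[OF vc d] by blast
  qed
  then have "positive_part (z - v) = 0"
    by (auto simp: positive_part_def fun_eq_iff)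
  then show ?thesis
    using I v z vc unfolding bck_ideal_def hahn_cone_def partial_object.simps bck.simps by metis
qed

lemma shadow_diff:
  assumes x: "x \<in> cone" and y: "y \<in> cone"
  shows "shadow x \<subseteq> shadow (positive_part (x - y)) \<union> shadow y"
proof
  fix \<delta> assume "\<delta> \<in> shadow x"
  then have d: "\<delta> \<in> \<Delta>" and p: "positive_at \<delta> x" using mem_shadow_iff[OF x] by auto
  from y d show "\<delta> \<in> shadow (positive_part (x - y)) \<union> shadow y"
  proof (cases rule: cone_cases)
    case 1
    then show ?thesis using mem_shadow_iff[OF y] d by blast
  next
    case 2
    then have "agree \<delta> (x - y) x" by (simp add: agree_def)
    from positive_part_cong[OF d this] have "agree \<delta> (positive_part (x - y)) x"
      by (simp add: positive_part_cone x)
    then show ?thesis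
      using \<open>\<delta> \<in> shadow x\<close> by (auto simp: shadow_def agree_def)
  qed
qed

lemma shadow_meet:
  assumes x: "x \<in> cone" and y: "y \<in> cone"
  shows "shadow x \<inter> shadow y \<subseteq> shadow (positive_part (y - positive_part (y - x)))"
proof
  fix \<delta> assume *: "\<delta> \<in> shadow x \<inter> shadow y"
  then have d: "\<delta> \<in> \<Delta>" by (simp add: shadow_def)
  show "\<delta> \<in> shadow (positive_part (y - positive_part (y - x)))"
    using meet_agree[OF x y d] * by (auto simp: shadow_def agree_def split: if_splits)
qed

lemma supported_bck_hahn_cone: "supported_bck hahn_cone shadow"
proof -
  interpret commutative_bck hahn_cone by (rule commutative_bck_hahn_cone)
  show ?thesis
  proof (unfold_locales)
    show "\<exists>F\<subseteq>shadow x. finite F \<and> (\<forall>z\<in>carrier hahn_cone. F \<subseteq> shadow z \<longrightarrow> shadow x \<subseteq> shadow z)"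
      if "x \<in> carrier hahn_cone" for x
    proof (intro exI conjI ballI impI)
      have x: "x \<in> cone" using that by (simp add: hahn_cone_def)
      show "{k. x k \<noteq> 0} \<subseteq> shadow x"
        using cone_outside[OF x] ord_refl by (auto simp: shadow_def)
      show "finite {k. x k \<noteq> 0}" by (rule cone_finite[OF x])
      fix z assume sub: "{k. x k \<noteq> 0} \<subseteq> shadow z"
      show "shadow x \<subseteq> shadow z"
      proof
        fix a assume "a \<in> shadow x"
        then obtain b where b: "a \<in> \<Delta>" "b \<in> \<Delta>" "a \<preceq> b" "x b \<noteq> 0"
          by (auto simp: shadow_def)
        then have "b \<in> shadow z" using sub by blast
        then obtain c where c: "c \<in> \<Delta>" "b \<preceq> c" "z c \<noteq> 0" by (auto simp: shadow_def)
        then have "a \<preceq> c" using ord_trans[of a b c] b by simp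
        then show "a \<in> shadow z" using b c by (auto simp: shadow_def)
      qed
    qed
    show "z \<in> I" if I: "bck_ideal hahn_cone I" and "x \<in> I" "y \<in> I" "z \<in> carrier hahn_cone"
      "shadow z \<subseteq> shadow x \<union> shadow y" for I x y z
    proof (rule ideal_absorbs_shadow[OF I])
      have "x \<in> cone" "y \<in> cone"
        using that bck_ideal_subset[OF I] by (auto simp: hahn_cone_def)
      then show "shadow z \<subseteq> shadow (x + y)" using that shadow_add by simp
      show "x + y \<in> I" using that ideal_add by blast
      show "z \<in> cone" using that by (simp add: hahn_cone_def)
    qed
    show "\<exists>z\<in>carrier hahn_cone. shadow z = shadow x \<union> shadow y"
      if "x \<in> carrier hahn_cone" "y \<in> carrier hahn_cone" for x y
      using that shadow_add[of x y] add_in_cone[of x y]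
      unfolding hahn_cone_def partial_object.simps by blast
    show "shadow \<zero>\<^bsub>hahn_cone\<^esub> = {}"
      by (simp add: hahn_cone_def shadow_def)
  qed (use shadow_diff shadow_meet in \<open>simp_all add: hahn_cone_def bck_meet_def\<close>)
qed

text \<open>
  A finite set \<open>F\<close> is the support of its characteristic function, which lies in the cone because it
  is nonnegative at every point.
\<close>

lemma shadows_eq_finite_down_sets:
  "shadow ` carrier hahn_cone = {{\<delta> \<in> \<Delta>. \<exists>k\<in>F. \<delta> \<preceq> k} | F. finite F \<and> F \<subseteq> \<Delta>}"
proof (intro subset_antisym subsetI)
  fix U assume "U \<in> shadow ` carrier hahn_cone"
  then obtain x where x: "x \<in> cone" "U = shadow x" by (auto simp: hahn_cone_def)
  then have "U = {\<delta> \<in> \<Delta>. \<exists>k\<in>{k. x k \<noteq> 0}. \<delta> \<preceq> k}"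
    using cone_outside by (auto simp: shadow_def)
  moreover have "finite {k. x k \<noteq> 0}" "{k. x k \<noteq> 0} \<subseteq> \<Delta>"
    using x cone_finite cone_outside by auto
  ultimately show "U \<in> {{\<delta> \<in> \<Delta>. \<exists>k\<in>F. \<delta> \<preceq> k} | F. finite F \<and> F \<subseteq> \<Delta>}" by blast
next
  fix U assume "U \<in> {{\<delta> \<in> \<Delta>. \<exists>k\<in>F. \<delta> \<preceq> k} | F. finite F \<and> F \<subseteq> \<Delta>}"
  then obtain F where F: "finite F" "F \<subseteq> \<Delta>" and U: "U = {\<delta> \<in> \<Delta>. \<exists>k\<in>F. \<delta> \<preceq> k}" by blast
  let ?x = "\<lambda>k. if k \<in> F then 1 else 0 :: int"
  have "?x \<in> cone"
    using F by (auto simp: cone_def positive_at_def)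
  moreover have "shadow ?x = U" using F U by (auto simp: shadow_def)
  ultimately show "U \<in> shadow ` carrier hahn_cone" by (auto simp: hahn_cone_def)
qed

end

text \<open>
  Transport along an injection \<open>\<phi>\<close> with left inverse \<open>\<psi>\<close>, used to pass from functions on pairs to curried
  functions.
\<close>

definition relabel_bck :: "('b \<Rightarrow> 'c) \<Rightarrow> ('c \<Rightarrow> 'b) \<Rightarrow> 'b bck \<Rightarrow> 'c bck" where
  "relabel_bck \<phi> \<psi> A = \<lparr>carrier = \<phi> ` carrier A, bck_sub = (\<lambda>x y. \<phi> (\<psi> x \<cdot>\<^bsub>A\<^esub> \<psi> y)), bck_zero = \<phi> \<zero>\<^bsub>A\<^esub>\<rparr>"

lemma supported_bck_relabel:
  fixes A :: "'b bck" (structure)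
  assumes A: "supported_bck A s" and inv: "\<And>x. \<psi> (\<phi> x) = x"
  shows "supported_bck (relabel_bck \<phi> \<psi> A) (\<lambda>y. s (\<psi> y))"
proof -
  interpret supported_bck A s by (rule A)
  let ?B = "relabel_bck \<phi> \<psi> A"
  have ideal: "bck_ideal A (\<psi> ` I)" if I: "bck_ideal ?B I" for I
    unfolding bck_ideal_def
  proof (intro conjI ballI impI)
    show "\<psi> ` I \<subseteq> carrier A"
      using bck_ideal_subset[OF I] inv by (auto simp: relabel_bck_def)
    have "\<phi> \<zero> \<in> I" using I by (simp add: bck_ideal_def relabel_bck_def)
    then show "\<zero> \<in> \<psi> ` I" using inv by (metis imageI)
    fix x y assume xy: "x \<in> carrier A" "y \<in> carrier A" and "x \<cdot> y \<in> \<psi> ` I \<and> y \<in> \<psi> ` I"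
    moreover have mem: "u \<in> \<psi> ` I \<longleftrightarrow> \<phi> u \<in> I" if "u \<in> carrier A" for u
    proof
      assume "u \<in> \<psi> ` I"
      then obtain v where v: "v \<in> I" "u = \<psi> v" by blast
      then obtain t where "v = \<phi> t" using bck_ideal_subset[OF I] by (auto simp: relabel_bck_def)
      then show "\<phi> u \<in> I" using v inv by simp
    next
      assume "\<phi> u \<in> I"
      then show "u \<in> \<psi> ` I" using inv by (metis imageI)
    qed
    ultimately have "\<phi> (x \<cdot> y) \<in> I" "\<phi> y \<in> I" using sub_closed by auto
    then have "\<phi> x \<in> I"
      using I xy inv unfolding bck_ideal_def relabel_bck_def partial_object.simps bck.simps
      by (metis imageI)
    then show "x \<in> \<psi> ` I" using mem xy by blast
  qed
  show ?thesis
  proof unfold_locales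
    show "z \<in> I" if I: "bck_ideal ?B I" and m: "x \<in> I" "y \<in> I" "z \<in> carrier ?B"
      and "s (\<psi> z) \<subseteq> s (\<psi> x) \<union> s (\<psi> y)" for I x y z
    proof -
      obtain t where t: "t \<in> carrier A" "z = \<phi> t" using m by (auto simp: relabel_bck_def)
      have "t \<in> \<psi> ` I"
        using ideal_absorbs[OF ideal[OF I] imageI[OF m(1)] imageI[OF m(2)] t(1)] that t inv by simp
      then obtain v where v: "v \<in> I" "t = \<psi> v" by blast
      then obtain r where "v = \<phi> r" using bck_ideal_subset[OF I] by (auto simp: relabel_bck_def)
      then show ?thesis using v t inv by simp
    qed
    show "\<exists>F\<subseteq>s (\<psi> x). finite F \<and> (\<forall>z\<in>carrier ?B. F \<subseteq> s (\<psi> z) \<longrightarrow> s (\<psi> x) \<subseteq> s (\<psi> z))"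
      if "x \<in> carrier ?B" for x
      using that support_generated inv by (auto simp: relabel_bck_def)
    show "\<exists>z\<in>carrier ?B. s (\<psi> z) = s (\<psi> x) \<union> s (\<psi> y)"
      if "x \<in> carrier ?B" "y \<in> carrier ?B" for x y
      using that support_join inv by (auto simp: relabel_bck_def)
    show "s (\<psi> x) \<inter> s (\<psi> y) \<subseteq> s (\<psi> (bck_meet ?B x y))"
      if xy: "x \<in> carrier ?B" "y \<in> carrier ?B" for x y
    proof -
      obtain t u where "t \<in> carrier A" "u \<in> carrier A" "x = \<phi> t" "y = \<phi> u"
        using xy by (auto simp: relabel_bck_def)
      then show ?thesis
        using support_meet[of t u] inv by (simp add: relabel_bck_def bck_meet_def)
    qed
    show "s (\<psi> x) \<subseteq> s (\<psi> (x \<cdot>\<^bsub>?B\<^esub> y)) \<union> s (\<psi> y)"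
      if xy: "x \<in> carrier ?B" "y \<in> carrier ?B" for x y
    proof -
      obtain t u where "t \<in> carrier A" "u \<in> carrier A" "x = \<phi> t" "y = \<phi> u"
        using xy by (auto simp: relabel_bck_def)
      then show ?thesis
        using support_sub[of t u] inv by (simp add: relabel_bck_def)
    qed
  qed (use zero_closed sub_closed sub_right_commute sub_sub_commute sub_self sub_zero support_zero
      in \<open>auto simp: relabel_bck_def inv\<close>)
qed

section \<open>Lattices generated by a forest of join-primes\<close>

text \<open>
  The least element is the empty join. Excluding it extends primality to all finite joins.
\<close>

definition join_primes :: "('a, 'm) gorder_scheme \<Rightarrow> 'a set" where
  "join_primes L = {p \<in> carrier L. \<not> least L p (carrier L) \<and>
     (\<forall>a\<in>carrier L. \<forall>b\<in>carrier L. p \<sqsubseteq>\<^bsub>L\<^esub> a \<squnion>\<^bsub>L\<^esub> b \<longrightarrow> p \<sqsubseteq>\<^bsub>L\<^esub> a \<or> p \<sqsubseteq>\<^bsub>L\<^esub> b)}"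

lemma join_primes_closed: "p \<in> join_primes L \<Longrightarrow> p \<in> carrier L"
  by (simp add: join_primes_def)

lemma join_primes_subset: "join_primes L \<subseteq> carrier L"
  by (auto simp: join_primes_def)

lemma (in upper_semilattice) join_prime_le_join_iff:
  assumes p: "p \<in> join_primes L" and ab: "a \<in> carrier L" "b \<in> carrier L"
  shows "p \<sqsubseteq> a \<squnion> b \<longleftrightarrow> p \<sqsubseteq> a \<or> p \<sqsubseteq> b"
proof -
  have "p \<sqsubseteq> a \<squnion> b" if "p \<sqsubseteq> a"
    using le_trans[OF that join_left[OF ab]] join_primes_closed[OF p] ab by simp
  moreover have "p \<sqsubseteq> a \<squnion> b" if "p \<sqsubseteq> b"
    using le_trans[OF that join_right[OF ab]] join_primes_closed[OF p] ab by simp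
  ultimately show ?thesis
    using p ab unfolding join_primes_def by blast
qed

lemma (in partial_order) join_prime_not_le_least:
  assumes p: "p \<in> join_primes L" and z: "least L z (carrier L)"
  shows "\<not> p \<sqsubseteq> z"
proof
  assume "p \<sqsubseteq> z"
  then have "p = z"
    using z join_primes_closed[OF p] by (auto simp: least_def)
  then show False using p z by (simp add: join_primes_def)
qed

text \<open>
  The empty join is a least upper bound of the empty set, which makes the least element an instance
  of \<open>generated\<close>. The existence of a least element has to be asked for separately: a chain
  without one satisfies the other two conditions, all its elements being join-prime.
\<close>

locale prime_forest_lattice = lattice +
  assumes least_exists: "\<exists>z. least L z (carrier L)"
    and generated: "a \<in> carrier L \<Longrightarrow> \<exists>F\<subseteq>join_primes L. finite F \<and> least L a (Upper L F)"
    and primes_above_chain: "\<lbrakk>p \<in> join_primes L; q \<in> join_primes L; r \<in> join_primes L;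
          p \<sqsubseteq> q; p \<sqsubseteq> r\<rbrakk> \<Longrightarrow> q \<sqsubseteq> r \<or> r \<sqsubseteq> q"
begin

lemma finite_join_of_primes:
  assumes "finite F" "F \<subseteq> join_primes L"
  shows "\<exists>a\<in>carrier L. \<forall>p\<in>join_primes L. p \<sqsubseteq> a \<longleftrightarrow> (\<exists>f\<in>F. p \<sqsubseteq> f)"
  using assms
proof (induction F rule: finite_induct)
  case empty
  obtain z where z: "least L z (carrier L)" using least_exists by blast
  then show ?case
    using join_prime_not_le_least[OF _ z] least_closed[OF z] by blast
next
  case (insert f F)
  have "F \<subseteq> join_primes L" using insert.prems by simp
  then obtain a where a: "a \<in> carrier L" "\<forall>p\<in>join_primes L. p \<sqsubseteq> a \<longleftrightarrow> (\<exists>f\<in>F. p \<sqsubseteq> f)"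
    using insert.IH by metis
  have f: "f \<in> carrier L" using insert.prems join_primes_subset[of L] by blast
  have "\<forall>p\<in>join_primes L. p \<sqsubseteq> f \<squnion> a \<longleftrightarrow> (\<exists>g\<in>insert f F. p \<sqsubseteq> g)"
    using join_prime_le_join_iff[OF _ f a(1)] a(2) by simp
  moreover have "f \<squnion> a \<in> carrier L" using f a by simp
  ultimately show ?case by blast
qed

text \<open>
  The join-primes below \<open>a\<close> form the down-set generated by the finite set \<open>F\<close> of joinands, since a
  join-prime below \<open>a\<close> lies below a member of \<open>F\<close>.
\<close>

lemma prime_generators:
  assumes a: "a \<in> carrier L"
  obtains F where "finite F" "F \<subseteq> join_primes L" "least L a (Upper L F)"
    "\<And>p. p \<in> join_primes L \<Longrightarrow> p \<sqsubseteq> a \<longleftrightarrow> (\<exists>f\<in>F. p \<sqsubseteq> f)"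
proof -
  obtain F where F: "finite F" "F \<subseteq> join_primes L" "least L a (Upper L F)"
    using generated[OF a] by blast
  have Fc: "F \<subseteq> carrier L" using F join_primes_subset[of L] by blast
  obtain b where b: "b \<in> carrier L" "\<forall>p\<in>join_primes L. p \<sqsubseteq> b \<longleftrightarrow> (\<exists>f\<in>F. p \<sqsubseteq> f)"
    using finite_join_of_primes[OF F(1,2)] by blast
  have "b \<in> Upper L F"
  proof (rule Upper_memI)
    fix f assume "f \<in> F"
    then have "f \<in> join_primes L" "f \<sqsubseteq> f" using F(2) Fc le_refl by blast+
    then have "f \<in> join_primes L" "\<exists>g\<in>F. f \<sqsubseteq> g" using \<open>f \<in> F\<close> by blast+
    then show "f \<sqsubseteq> b" using b(2) by simp
  qed (rule b(1))
  then have ab: "a \<sqsubseteq> b" using F(3) by (simp add: least_def)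
  have "p \<sqsubseteq> a \<longleftrightarrow> (\<exists>f\<in>F. p \<sqsubseteq> f)" if p: "p \<in> join_primes L" for p
  proof
    assume "p \<sqsubseteq> a"
    then have "p \<sqsubseteq> b" using le_trans[OF _ ab _ a b(1)] join_primes_closed[OF p] by simp
    then show "\<exists>f\<in>F. p \<sqsubseteq> f" using b p by blast
  next
    assume "\<exists>f\<in>F. p \<sqsubseteq> f"
    then obtain f where f: "f \<in> F" "p \<sqsubseteq> f" by blast
    have "f \<sqsubseteq> a" using least_Upper_above[OF F(3) f(1) Fc] .
    then show "p \<sqsubseteq> a" using le_trans[OF f(2) _ join_primes_closed[OF p] _ a] f(1) Fc by blast
  qed
  then show thesis using that F by blast
qed

lemma le_iff_primes:
  assumes a: "a \<in> carrier L" and b: "b \<in> carrier L"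
  shows "a \<sqsubseteq> b \<longleftrightarrow> (\<forall>p\<in>join_primes L. p \<sqsubseteq> a \<longrightarrow> p \<sqsubseteq> b)"
proof
  assume ab: "a \<sqsubseteq> b"
  show "\<forall>p\<in>join_primes L. p \<sqsubseteq> a \<longrightarrow> p \<sqsubseteq> b"
  proof (intro ballI impI)
    fix p assume "p \<in> join_primes L" "p \<sqsubseteq> a"
    then show "p \<sqsubseteq> b" using le_trans[OF _ ab _ a b] join_primes_closed[of p L] by simp
  qed
next
  assume *: "\<forall>p\<in>join_primes L. p \<sqsubseteq> a \<longrightarrow> p \<sqsubseteq> b"
  obtain F where F: "finite F" "F \<subseteq> join_primes L" "least L a (Upper L F)"
    "\<And>p. p \<in> join_primes L \<Longrightarrow> p \<sqsubseteq> a \<longleftrightarrow> (\<exists>f\<in>F. p \<sqsubseteq> f)"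
    by (rule prime_generators[OF a]) (rule that)
  have "b \<in> Upper L F"
  proof (rule Upper_memI)
    fix f assume "f \<in> F"
    then have "f \<in> join_primes L" "f \<sqsubseteq> f" using F(2) join_primes_subset[of L] le_refl by blast+
    then have "f \<in> join_primes L" "\<exists>g\<in>F. f \<sqsubseteq> g" using \<open>f \<in> F\<close> by blast+
    then show "f \<sqsubseteq> b" using * F(4) by simp
  qed (rule b)
  then show "a \<sqsubseteq> b" using F(3) by (simp add: least_def)
qed

end

lemma lattice_product_order:
  assumes D: "\<And>i. i \<in> I \<Longrightarrow> lattice (D i)"
  shows "lattice (product_order I D)"
proof -
  let ?P = "product_order I D"
  have po: "partial_order (D i)" if "i \<in> I" for i
    using D[OF that] by (simp add: lattice_def upper_semilattice_def)
  have wpo: "weak_partial_order (D i)" if "i \<in> I" for i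
    using po[OF that] by (simp add: partial_order_def)
  have car: "x i \<in> carrier (D i)" if "x \<in> carrier ?P" "i \<in> I" for x i
    using that by (auto simp: product_order_def)
  interpret partial_order ?P
  proof
    have "x = y" if xy: "x \<sqsubseteq>\<^bsub>?P\<^esub> y" "y \<sqsubseteq>\<^bsub>?P\<^esub> x" "x \<in> carrier ?P" "y \<in> carrier ?P" for x y
    proof (rule PiE_ext)
      show "x \<in> (\<Pi>\<^sub>E i\<in>I. carrier (D i))" "y \<in> (\<Pi>\<^sub>E i\<in>I. carrier (D i))"
        using xy by (simp_all add: product_order_def)
      fix i assume i: "i \<in> I"
      show "x i = y i"
      proof (rule partial_order.le_antisym[OF po[OF i]])
        show "x i \<sqsubseteq>\<^bsub>D i\<^esub> y i" "y i \<sqsubseteq>\<^bsub>D i\<^esub> x i" using xy i by (simp_all add: product_order_def)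
      qed (use car xy i in auto)
    qed
    then show "x .=\<^bsub>?P\<^esub> y" if "x \<sqsubseteq>\<^bsub>?P\<^esub> y" "y \<sqsubseteq>\<^bsub>?P\<^esub> x" "x \<in> carrier ?P" "y \<in> carrier ?P" for x y
      using that by (simp add: product_order_def)
    show "x \<sqsubseteq>\<^bsub>?P\<^esub> z" if "x \<sqsubseteq>\<^bsub>?P\<^esub> y" "y \<sqsubseteq>\<^bsub>?P\<^esub> z" "x \<in> carrier ?P" "y \<in> carrier ?P" "z \<in> carrier ?P" for x y z
      unfolding product_order_def gorder.simps
    proof
      fix i assume i: "i \<in> I"
      show "x i \<sqsubseteq>\<^bsub>D i\<^esub> z i"
      proof (rule weak_partial_order.le_trans[OF wpo[OF i]])
        show "x i \<sqsubseteq>\<^bsub>D i\<^esub> y i" "y i \<sqsubseteq>\<^bsub>D i\<^esub> z i" using that i by (simp_all add: product_order_def)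
      qed (use car that i in auto)
    qed
    show "x \<sqsubseteq>\<^bsub>?P\<^esub> x" if "x \<in> carrier ?P" for x
      using that weak_partial_order.le_refl[OF wpo] car[OF that] by (simp add: product_order_def)
  qed (auto simp: product_order_def)
  show ?thesis
  proof
    fix x y assume x: "x \<in> carrier ?P" and y: "y \<in> carrier ?P"
    let ?j = "\<lambda>i\<in>I. x i \<squnion>\<^bsub>D i\<^esub> y i" and ?m = "\<lambda>i\<in>I. x i \<sqinter>\<^bsub>D i\<^esub> y i"
    have jc: "x i \<squnion>\<^bsub>D i\<^esub> y i \<in> carrier (D i)" "x i \<sqsubseteq>\<^bsub>D i\<^esub> x i \<squnion>\<^bsub>D i\<^esub> y i" "y i \<sqsubseteq>\<^bsub>D i\<^esub> x i \<squnion>\<^bsub>D i\<^esub> y i"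
      and mc: "x i \<sqinter>\<^bsub>D i\<^esub> y i \<in> carrier (D i)" "x i \<sqinter>\<^bsub>D i\<^esub> y i \<sqsubseteq>\<^bsub>D i\<^esub> x i" "x i \<sqinter>\<^bsub>D i\<^esub> y i \<sqsubseteq>\<^bsub>D i\<^esub> y i"
      if i: "i \<in> I" for i
    proof -
      interpret L: lattice "D i" by (rule D[OF i])
      show "x i \<squnion>\<^bsub>D i\<^esub> y i \<in> carrier (D i)" "x i \<sqsubseteq>\<^bsub>D i\<^esub> x i \<squnion>\<^bsub>D i\<^esub> y i" "y i \<sqsubseteq>\<^bsub>D i\<^esub> x i \<squnion>\<^bsub>D i\<^esub> y i"
        "x i \<sqinter>\<^bsub>D i\<^esub> y i \<in> carrier (D i)" "x i \<sqinter>\<^bsub>D i\<^esub> y i \<sqsubseteq>\<^bsub>D i\<^esub> x i" "x i \<sqinter>\<^bsub>D i\<^esub> y i \<sqsubseteq>\<^bsub>D i\<^esub> y i"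
        using car[OF x i] car[OF y i] L.join_left L.join_right L.meet_left L.meet_right by simp_all
    qed
    have jle: "x i \<squnion>\<^bsub>D i\<^esub> y i \<sqsubseteq>\<^bsub>D i\<^esub> z" if "i \<in> I" "z \<in> carrier (D i)" "x i \<sqsubseteq>\<^bsub>D i\<^esub> z" "y i \<sqsubseteq>\<^bsub>D i\<^esub> z" for i z
    proof -
      interpret L: lattice "D i" by (rule D[OF that(1)])
      show ?thesis using that car[OF x that(1)] car[OF y that(1)] by (intro L.join_le)
    qed
    have mle: "z \<sqsubseteq>\<^bsub>D i\<^esub> x i \<sqinter>\<^bsub>D i\<^esub> y i" if "i \<in> I" "z \<in> carrier (D i)" "z \<sqsubseteq>\<^bsub>D i\<^esub> x i" "z \<sqsubseteq>\<^bsub>D i\<^esub> y i" for i z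
    proof -
      interpret L: lattice "D i" by (rule D[OF that(1)])
      show ?thesis using that car[OF x that(1)] car[OF y that(1)] by (intro L.meet_le)
    qed
    have "least ?P ?j (Upper ?P {x, y})"
    proof (rule least_UpperI)
      show "?j \<sqsubseteq>\<^bsub>?P\<^esub> b" if b: "b \<in> Upper ?P {x, y}" for b
      proof -
        have "x \<sqsubseteq>\<^bsub>?P\<^esub> b" "y \<sqsubseteq>\<^bsub>?P\<^esub> b" "b \<in> carrier ?P"
          using b x y unfolding Upper_def by blast+
        then show ?thesis using jle car by (simp add: product_order_def)
      qed
    qed (use x y jc in \<open>auto simp: product_order_def\<close>)
    then show "\<exists>s. least ?P s (Upper ?P {x, y})" by blast
    have "greatest ?P ?m (Lower ?P {x, y})"
    proof (rule greatest_LowerI)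
      show "b \<sqsubseteq>\<^bsub>?P\<^esub> ?m" if b: "b \<in> Lower ?P {x, y}" for b
      proof -
        have "b \<sqsubseteq>\<^bsub>?P\<^esub> x" "b \<sqsubseteq>\<^bsub>?P\<^esub> y" "b \<in> carrier ?P"
          using b x y unfolding Lower_def by blast+
        then show ?thesis using mle car by (simp add: product_order_def)
      qed
    qed (use x y mc in \<open>auto simp: product_order_def\<close>)
    then show "\<exists>s. greatest ?P s (Lower ?P {x, y})" by blast
  qed
qed

text \<open>
  The join-primes of a product are those tuples with a join-prime of one factor in its place and the least element
  everywhere else. They are represented by pairs of an index and a join-prime of that factor,
  and comparable only within one factor.
\<close>

definition prime_index :: "'i set \<Rightarrow> ('i \<Rightarrow> 'a gorder) \<Rightarrow> ('i \<times> 'a) set" where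
  "prime_index I D = (SIGMA i:I. join_primes (D i))"

definition prime_order :: "('i \<Rightarrow> 'a gorder) \<Rightarrow> 'i \<times> 'a \<Rightarrow> 'i \<times> 'a \<Rightarrow> bool" where
  "prime_order D u v \<longleftrightarrow> fst u = fst v \<and> snd u \<sqsubseteq>\<^bsub>D (fst u)\<^esub> snd v"

definition primes_below :: "'i set \<Rightarrow> ('i \<Rightarrow> 'a gorder) \<Rightarrow> ('i \<Rightarrow> 'a) \<Rightarrow> ('i \<times> 'a) set" where
  "primes_below I D a = {u \<in> prime_index I D. snd u \<sqsubseteq>\<^bsub>D (fst u)\<^esub> a (fst u)}"

lemma primes_below_subset_iff:
  assumes D: "\<And>i. i \<in> I \<Longrightarrow> prime_forest_lattice (D i)"
    and a: "a \<in> carrier (product_order I D)" and b: "b \<in> carrier (product_order I D)"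
  shows "primes_below I D a \<subseteq> primes_below I D b \<longleftrightarrow> a \<sqsubseteq>\<^bsub>product_order I D\<^esub> b"
proof -
  have "a i \<sqsubseteq>\<^bsub>D i\<^esub> b i \<longleftrightarrow> (\<forall>p\<in>join_primes (D i). p \<sqsubseteq>\<^bsub>D i\<^esub> a i \<longrightarrow> p \<sqsubseteq>\<^bsub>D i\<^esub> b i)"
    if "i \<in> I" for i
  proof (rule prime_forest_lattice.le_iff_primes[OF D[OF that]])
    show "a i \<in> carrier (D i)" "b i \<in> carrier (D i)"
      using a b that by (auto simp: product_order_def)
  qed
  then show ?thesis
    by (auto simp: primes_below_def prime_index_def product_order_def subset_iff)
qed

lemma primes_below_image:
  assumes I: "finite I" and D: "\<And>i. i \<in> I \<Longrightarrow> prime_forest_lattice (D i)"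
  shows "primes_below I D ` carrier (product_order I D) =
    {{u \<in> prime_index I D. \<exists>v\<in>F. prime_order D u v} | F. finite F \<and> F \<subseteq> prime_index I D}"
proof (intro subset_antisym subsetI)
  fix U assume "U \<in> primes_below I D ` carrier (product_order I D)"
  then obtain a where a: "a \<in> carrier (product_order I D)" and U: "U = primes_below I D a" by blast
  have "\<exists>F. finite F \<and> F \<subseteq> join_primes (D i) \<and>
      (\<forall>p\<in>join_primes (D i). p \<sqsubseteq>\<^bsub>D i\<^esub> a i \<longleftrightarrow> (\<exists>f\<in>F. p \<sqsubseteq>\<^bsub>D i\<^esub> f))" if i: "i \<in> I" for i
  proof -
    have "a i \<in> carrier (D i)" using a i by (auto simp: product_order_def)
    then show ?thesis by (rule prime_forest_lattice.prime_generators[OF D[OF i]]) blast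
  qed
  then obtain F where F: "\<And>i. i \<in> I \<Longrightarrow> finite (F i) \<and> F i \<subseteq> join_primes (D i) \<and>
      (\<forall>p\<in>join_primes (D i). p \<sqsubseteq>\<^bsub>D i\<^esub> a i \<longleftrightarrow> (\<exists>f\<in>F i. p \<sqsubseteq>\<^bsub>D i\<^esub> f))"
    by metis
  have "U = {u \<in> prime_index I D. \<exists>v\<in>Sigma I F. prime_order D u v}"
    unfolding U primes_below_def using F by (force simp: prime_index_def prime_order_def)
  moreover have "finite (Sigma I F)" using I F by blast
  moreover have "Sigma I F \<subseteq> prime_index I D" using F by (auto simp: prime_index_def)
  ultimately show "U \<in> {{u \<in> prime_index I D. \<exists>v\<in>F. prime_order D u v} | F. finite F \<and> F \<subseteq> prime_index I D}"
    by blast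
next
  fix U assume "U \<in> {{u \<in> prime_index I D. \<exists>v\<in>F. prime_order D u v} | F. finite F \<and> F \<subseteq> prime_index I D}"
  then obtain F where F: "finite F" "F \<subseteq> prime_index I D"
    and U: "U = {u \<in> prime_index I D. \<exists>v\<in>F. prime_order D u v}" by blast
  have "\<exists>c\<in>carrier (D i). \<forall>p\<in>join_primes (D i). p \<sqsubseteq>\<^bsub>D i\<^esub> c \<longleftrightarrow> (\<exists>f\<in>F `` {i}. p \<sqsubseteq>\<^bsub>D i\<^esub> f)"
    if i: "i \<in> I" for i
  proof (rule prime_forest_lattice.finite_join_of_primes[OF D[OF i]])
    show "finite (F `` {i})" using F(1) by (rule finite_Image)
    show "F `` {i} \<subseteq> join_primes (D i)" using F(2) by (auto simp: prime_index_def)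
  qed
  then obtain c where c: "\<And>i. i \<in> I \<Longrightarrow> c i \<in> carrier (D i) \<and>
      (\<forall>p\<in>join_primes (D i). p \<sqsubseteq>\<^bsub>D i\<^esub> c i \<longleftrightarrow> (\<exists>f\<in>F `` {i}. p \<sqsubseteq>\<^bsub>D i\<^esub> f))"
    by metis
  have "restrict c I \<in> carrier (product_order I D)" using c by (simp add: product_order_def)
  moreover have "primes_below I D (restrict c I) = U"
    unfolding U primes_below_def
  proof (rule Collect_cong)
    fix u :: "'a \<times> 'b"
    show "u \<in> prime_index I D \<and> snd u \<sqsubseteq>\<^bsub>D (fst u)\<^esub> restrict c I (fst u) \<longleftrightarrow>
        u \<in> prime_index I D \<and> (\<exists>v\<in>F. prime_order D u v)"
    proof (cases u)
      case (Pair i p)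
      have "(\<exists>f\<in>F `` {i}. p \<sqsubseteq>\<^bsub>D i\<^esub> f) \<longleftrightarrow> (\<exists>v\<in>F. prime_order D u v)"
        unfolding Pair by (force simp: prime_order_def)
      then show ?thesis using c[of i] by (auto simp: Pair prime_index_def)
    qed
  qed
  ultimately show "U \<in> primes_below I D ` carrier (product_order I D)" by blast
qed

section \<open>Finite distributive lattices\<close>

lemma (in partial_order) finite_has_minimal:
  assumes "finite X" "X \<noteq> {}" "X \<subseteq> carrier L"
  obtains m where "m \<in> X" "\<And>x. x \<in> X \<Longrightarrow> x \<sqsubseteq> m \<Longrightarrow> x = m"
proof -
  let ?R = "\<lambda>a b. a \<sqsubseteq> b \<and> a \<noteq> b"
  have "asymp_on X ?R"
    using assms(3) by (auto simp: asymp_on_def intro: le_antisym)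
  moreover have "transp_on X ?R"
  proof (rule transp_onI)
    fix a b c assume abc: "a \<in> X" "b \<in> X" "c \<in> X" "?R a b" "?R b c"
    then have car: "a \<in> carrier L" "b \<in> carrier L" "c \<in> carrier L" using assms(3) by auto
    then have "a \<sqsubseteq> c" using le_trans[of a b c] abc by simp
    moreover have "a \<noteq> c" using le_antisym[of a b] abc car by auto
    ultimately show "?R a c" by simp
  qed
  ultimately obtain m where "m \<in> X" "\<forall>x\<in>X. x \<noteq> m \<longrightarrow> \<not> ?R x m"
    using Finite_Set.bex_min_element[of X ?R] assms by blast
  then show thesis using that by blast
qed

lemma (in lattice) finite_has_least:
  assumes "finite (carrier L)" "carrier L \<noteq> {}"
  shows "\<exists>z. least L z (carrier L)"
proof -
  obtain m where m: "m \<in> carrier L" "\<And>x. x \<in> carrier L \<Longrightarrow> x \<sqsubseteq> m \<Longrightarrow> x = m"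
    using finite_has_minimal[OF assms] by blast
  have "m \<sqsubseteq> x" if x: "x \<in> carrier L" for x
    using m(2)[OF meet_closed[OF m(1) x] meet_left[OF m(1) x]] meet_right[OF m(1) x] by simp
  then show ?thesis using m(1) by (auto simp: least_def)
qed

context distributive_lattice
begin

lemma join_meet_distrib:
  assumes "x \<in> carrier L" "y \<in> carrier L" "z \<in> carrier L"
  shows "x \<squnion> (y \<sqinter> z) = (x \<squnion> y) \<sqinter> (x \<squnion> z)"
proof -
  have "(x \<squnion> y) \<sqinter> (x \<squnion> z) = ((x \<squnion> y) \<sqinter> x) \<squnion> ((x \<squnion> y) \<sqinter> z)"
    using assms meet_join_distrib by simp
  also have "(x \<squnion> y) \<sqinter> x = x"
    using assms le_iff_join[of x "x \<squnion> y"] join_left by (simp add: meet_comm)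
  also have "(x \<squnion> y) \<sqinter> z = (x \<sqinter> z) \<squnion> (y \<sqinter> z)"
    using assms meet_join_distrib[of z x y] by (simp add: meet_comm)
  also have "x \<squnion> ((x \<sqinter> z) \<squnion> (y \<sqinter> z)) = (x \<squnion> (x \<sqinter> z)) \<squnion> (y \<sqinter> z)"
    using assms by (simp add: join_assoc)
  also have "x \<squnion> (x \<sqinter> z) = x"
    using assms le_iff_meet[of "x \<sqinter> z" x] meet_left by (simp add: join_comm)
  finally show ?thesis by simp
qed

lemma relative_complement_unique:
  assumes xyb: "x \<in> carrier L" "y \<in> carrier L" "b \<in> carrier L"
    and m: "x \<sqinter> b = y \<sqinter> b" and j: "x \<squnion> b = y \<squnion> b"
  shows "x = y"
proof -
  have "u \<sqsubseteq> v" if u: "u \<in> carrier L" and v: "v \<in> carrier L" and m: "u \<sqinter> b = v \<sqinter> b" and j: "u \<squnion> b = v \<squnion> b" for u v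
  proof -
    have "u = u \<sqinter> (u \<squnion> b)"
      using le_iff_join[of u "u \<squnion> b"] join_left u xyb(3) by simp
    also have "\<dots> = (u \<sqinter> v) \<squnion> (u \<sqinter> b)"
      using u v xyb(3) by (simp add: j meet_join_distrib)
    also have "\<dots> \<sqsubseteq> v"
      using u v xyb(3) m meet_left[of v b] meet_right[of u v] by (intro join_le) simp_all
    finally show ?thesis .
  qed
  then show ?thesis using assms by (intro le_antisym) simp_all
qed

text \<open>
  A minimal element \<open>p\<close> among those below \<open>a\<close> but not below \<open>b\<close> is join-prime: if \<open>p\<close> is below
  \<open>c \<squnion> d\<close> but below neither joinand, then \<open>p \<sqinter> c\<close> and \<open>p \<sqinter> d\<close> are smaller than \<open>p\<close>, hence below \<open>b\<close>,
  and so is their join \<open>p\<close>.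
\<close>

lemma join_prime_separates:
  assumes fin: "finite (carrier L)" and a: "a \<in> carrier L" and b: "b \<in> carrier L" and ab: "\<not> a \<sqsubseteq> b"
  shows "\<exists>p\<in>join_primes L. p \<sqsubseteq> a \<and> \<not> p \<sqsubseteq> b"
proof -
  let ?X = "{x \<in> carrier L. x \<sqsubseteq> a \<and> \<not> x \<sqsubseteq> b}"
  have "finite ?X" "?X \<noteq> {}" "?X \<subseteq> carrier L" using fin a ab by auto
  then obtain p where p: "p \<in> ?X" and min: "\<And>x. x \<in> ?X \<Longrightarrow> x \<sqsubseteq> p \<Longrightarrow> x = p"
    by (rule finite_has_minimal) blast
  have pc: "p \<in> carrier L" using p by simp
  have part: "c \<in> carrier L \<Longrightarrow> p \<sqsubseteq> c \<or> p \<sqinter> c \<sqsubseteq> b" for c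
  proof (rule disjCI)
    assume c: "c \<in> carrier L" and "\<not> p \<sqinter> c \<sqsubseteq> b"
    then have "p \<sqinter> c \<in> ?X"
      using p a le_trans[OF meet_left[OF pc c]] by simp
    then have "p \<sqinter> c = p" using min meet_left[OF pc c] by blast
    then show "p \<sqsubseteq> c" using meet_right[OF pc c] by simp
  qed
  have "p \<sqsubseteq> c \<or> p \<sqsubseteq> d" if c: "c \<in> carrier L" and d: "d \<in> carrier L" and le: "p \<sqsubseteq> c \<squnion> d" for c d
  proof (rule ccontr)
    assume "\<not> (p \<sqsubseteq> c \<or> p \<sqsubseteq> d)"
    then have "p \<sqinter> c \<sqsubseteq> b" "p \<sqinter> d \<sqsubseteq> b" using part c d by blast+
    then have "(p \<sqinter> c) \<squnion> (p \<sqinter> d) \<sqsubseteq> b" using b pc c d by (intro join_le) simp_all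
    moreover have "p = (p \<sqinter> c) \<squnion> (p \<sqinter> d)"
      using le le_iff_join[of p "c \<squnion> d"] meet_join_distrib[of p c d] pc c d by simp
    ultimately show False using p by simp
  qed
  moreover have "\<not> least L p (carrier L)" using p b by (auto simp: least_def)
  ultimately have "p \<in> join_primes L" unfolding join_primes_def using pc by blast
  then show ?thesis using p by blast
qed

text \<open>
  Separation by join-primes says that every element is the join of the join-primes below it, and
  there are only finitely many of these.
\<close>

lemma finite_prime_forestI:
  assumes fin: "finite (carrier L)"
    and chain: "\<And>p q r. \<lbrakk>p \<in> join_primes L; q \<in> join_primes L; r \<in> join_primes L; p \<sqsubseteq> q; p \<sqsubseteq> r\<rbrakk>
      \<Longrightarrow> q \<sqsubseteq> r \<or> r \<sqsubseteq> q"
  shows "prime_forest_lattice L"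
proof
  show "\<exists>z. least L z (carrier L)" using finite_has_least[OF fin carrier_nonempty] .
  fix a assume a: "a \<in> carrier L"
  let ?F = "{p \<in> join_primes L. p \<sqsubseteq> a}"
  have F: "?F \<subseteq> carrier L" using join_primes_subset[of L] by blast
  have "least L a (Upper L ?F)"
  proof (rule least_UpperI)
    fix b assume b: "b \<in> Upper L ?F"
    then have bc: "b \<in> carrier L" by (auto simp: Upper_def)
    have "p \<sqsubseteq> b" if "p \<in> ?F" for p using b that F unfolding Upper_def by blast
    then show "a \<sqsubseteq> b" using join_prime_separates[OF fin a bc] by blast
  qed (use a F in auto)
  moreover have "finite ?F" using F fin by (rule finite_subset)
  ultimately show "\<exists>F\<subseteq>join_primes L. finite F \<and> least L a (Upper L F)"
    by (intro exI[of _ ?F]) simp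
qed (rule chain)

end

section \<open>Factors with a tree of meet-irreducibles\<close>

text \<open>
  The elements not above a join-prime form an ideal; in a finite lattice, it has a greatest
  element \<open>m\<close>. Any element strictly above \<open>m\<close> is above \<open>p\<close>, and so is any meet of such elements,
  which is why \<open>m\<close> is meet-irreducible.
\<close>

lemma (in distributive_lattice) greatest_not_above_join_prime:
  assumes fin: "finite (carrier L)" and p: "p \<in> join_primes L"
  shows "\<exists>m\<in>meet_irreducibles L. \<forall>x\<in>carrier L. \<not> p \<sqsubseteq> x \<longleftrightarrow> x \<sqsubseteq> m"
proof -
  have pc: "p \<in> carrier L" using p by (rule join_primes_closed)
  let ?X = "{x \<in> carrier L. \<not> p \<sqsubseteq> x}"
  interpret dual: partial_order "inv_gorder L" by (rule dual_order)
  obtain z where z: "least L z (carrier L)" using finite_has_least[OF fin carrier_nonempty] by blast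
  have "z \<in> ?X" using join_prime_not_le_least[OF p z] z by (auto simp: least_def)
  then have "finite ?X" "?X \<noteq> {}" "?X \<subseteq> carrier (inv_gorder L)" using fin by auto
  then obtain m where m: "m \<in> ?X" and max: "\<And>x. x \<in> ?X \<Longrightarrow> m \<sqsubseteq> x \<Longrightarrow> x = m"
    by (rule dual.finite_has_minimal) auto
  have mc: "m \<in> carrier L" and pm: "\<not> p \<sqsubseteq> m" using m by auto
  have iff: "\<not> p \<sqsubseteq> x \<longleftrightarrow> x \<sqsubseteq> m" if x: "x \<in> carrier L" for x
  proof
    assume "\<not> p \<sqsubseteq> x"
    then have "m \<squnion> x \<in> ?X" using join_prime_le_join_iff[OF p mc x] pm mc x by simp
    then have "m \<squnion> x = m" using max join_left[OF mc x] by blast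
    then show "x \<sqsubseteq> m" using join_right[OF mc x] by simp
  next
    assume "x \<sqsubseteq> m"
    then show "\<not> p \<sqsubseteq> x" using pm le_trans[of p x m] pc x mc by blast
  qed
  have "\<not> greatest L m (carrier L)" using pm pc by (auto simp: greatest_def)
  moreover have "m = a \<or> m = b" if a: "a \<in> carrier L" and b: "b \<in> carrier L" and eq: "m = a \<sqinter> b" for a b
  proof (rule ccontr)
    assume ne: "\<not> (m = a \<or> m = b)"
    have "m \<sqsubseteq> a" "m \<sqsubseteq> b" using eq a b meet_left meet_right by auto
    then have "p \<sqsubseteq> a" "p \<sqsubseteq> b" using ne max a b by blast+
    then have "p \<sqsubseteq> m" using eq meet_le[of p a b] a b pc by simp
    then show False using pm by simp
  qed
  ultimately have "m \<in> meet_irreducibles L" unfolding meet_irreducibles_def using mc by blast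
  then show ?thesis using iff by blast
qed

lemma (in rooted_tree) ancestors_chain:
  assumes "(u, v) \<in> E\<^sup>*" "(w, v) \<in> E\<^sup>*"
  shows "(u, w) \<in> E\<^sup>* \<or> (w, u) \<in> E\<^sup>*"
proof -
  have "single_valued (E\<inverse>)"
    using unique_parent root_no_parent edges by (fastforce simp: single_valued_def)
  moreover have "(v, u) \<in> (E\<inverse>)\<^sup>*" "(v, w) \<in> (E\<inverse>)\<^sup>*"
    using assms by (simp_all add: rtrancl_converse)
  ultimately have "(u, w) \<in> (E\<inverse>)\<^sup>* \<or> (w, u) \<in> (E\<inverse>)\<^sup>*"
    by (rule single_valued_confluent)
  then show ?thesis by (auto simp: rtrancl_converse)
qed

text \<open>
  The assignment \<open>\<mu>\<close> of the previous lemma embeds the join-primes into the meet-irreducibles as a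
  poset. In the dual of a tree, the elements above a given one are its ancestors, which form
  a chain.
\<close>

lemma tree_type_prime_forest:
  fixes L :: "'a gorder" (structure)
  assumes "tree_type L"
  shows "prime_forest_lattice L"
proof -
  interpret distributive_lattice L using assms by (simp add: tree_type_def)
  have fin: "finite (carrier L)" using assms by (simp add: tree_type_def)
  obtain V E root and f :: "'a \<Rightarrow> nat" where tree: "rooted_tree V E root"
    and f: "order_emb (MI_poset L) (inv_gorder (ancestor_order V E)) f"
    using assms unfolding tree_type_def order_isomorphic_def by blast
  interpret rooted_tree V E root by (rule tree)
  have f_le: "(f n, f m) \<in> E\<^sup>* \<longleftrightarrow> m \<sqsubseteq> n" if "m \<in> meet_irreducibles L" "n \<in> meet_irreducibles L" for m n
    using f that by (simp add: order_emb_def MI_poset_def ancestor_order_def)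
  obtain \<mu> where \<mu>: "\<And>p. p \<in> join_primes L \<Longrightarrow>
      \<mu> p \<in> meet_irreducibles L \<and> (\<forall>x\<in>carrier L. \<not> p \<sqsubseteq> x \<longleftrightarrow> x \<sqsubseteq> \<mu> p)"
    using greatest_not_above_join_prime[OF fin] by metis
  have \<mu>c: "\<mu> p \<in> carrier L" if "p \<in> join_primes L" for p
    using \<mu>[OF that] by (simp add: meet_irreducibles_def)
  have \<mu>_le: "\<mu> p \<sqsubseteq> \<mu> q \<longleftrightarrow> p \<sqsubseteq> q" if p: "p \<in> join_primes L" and q: "q \<in> join_primes L" for p q
  proof -
    have c: "p \<in> carrier L" "q \<in> carrier L" using p q by (simp_all add: join_primes_closed)
    have "\<not> p \<sqsubseteq> \<mu> p" using \<mu>[OF p] \<mu>c[OF p] le_refl by blast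
    show ?thesis
    proof
      assume "\<mu> p \<sqsubseteq> \<mu> q"
      moreover have "\<not> q \<sqsubseteq> \<mu> q" using \<mu>[OF q] \<mu>c[OF q] le_refl by blast
      ultimately have "\<not> q \<sqsubseteq> \<mu> p" using le_trans[of q "\<mu> p" "\<mu> q"] c \<mu>c p q by blast
      then show "p \<sqsubseteq> q" using \<mu>[OF p] c(2) by blast
    next
      assume "p \<sqsubseteq> q"
      then have "\<not> q \<sqsubseteq> \<mu> p" using \<open>\<not> p \<sqsubseteq> \<mu> p\<close> le_trans[of p q "\<mu> p"] c \<mu>c p by blast
      then show "\<mu> p \<sqsubseteq> \<mu> q" using \<mu>[OF q] \<mu>c[OF p] by blast
    qed
  qed
  show ?thesis
  proof (rule finite_prime_forestI[OF fin])
    fix p q r assume J: "p \<in> join_primes L" "q \<in> join_primes L" "r \<in> join_primes L"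
      and le: "p \<sqsubseteq> q" "p \<sqsubseteq> r"
    have "(f (\<mu> q), f (\<mu> p)) \<in> E\<^sup>*" "(f (\<mu> r), f (\<mu> p)) \<in> E\<^sup>*"
      using J le \<mu> \<mu>_le f_le by simp_all
    from ancestors_chain[OF this] show "q \<sqsubseteq> r \<or> r \<sqsubseteq> q"
      using J \<mu> \<mu>_le f_le by auto
  qed
qed

section \<open>Chains\<close>

lemma chain_prime_forest:
  assumes "total_order L" and least: "\<exists>z. least L z (carrier L)"
  shows "prime_forest_lattice L"
proof -
  interpret total_order L by fact
  have prime: "p \<in> join_primes L" if p: "p \<in> carrier L" "\<not> least L p (carrier L)" for p
  proof -
    have "p \<sqsubseteq>\<^bsub>L\<^esub> a \<or> p \<sqsubseteq>\<^bsub>L\<^esub> b"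
      if ab: "a \<in> carrier L" "b \<in> carrier L" and le: "p \<sqsubseteq>\<^bsub>L\<^esub> a \<squnion>\<^bsub>L\<^esub> b" for a b
      using total_order_total[OF ab] le le_iff_meet[OF ab] le_iff_meet[OF ab(2,1)] join_comm[of L a b] by auto
    then show ?thesis using p by (auto simp: join_primes_def)
  qed
  show ?thesis
  proof
    show "\<exists>z. least L z (carrier L)" by (rule least)
    show "q \<sqsubseteq>\<^bsub>L\<^esub> r \<or> r \<sqsubseteq>\<^bsub>L\<^esub> q" if "q \<in> join_primes L" "r \<in> join_primes L" for q r
      using total_order_total[OF join_primes_closed[OF that(1)] join_primes_closed[OF that(2)]] .
    fix a assume a: "a \<in> carrier L"
    show "\<exists>F\<subseteq>join_primes L. finite F \<and> least L a (Upper L F)"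
    proof (cases "least L a (carrier L)")
      case True
      then show ?thesis by (intro exI[of _ "{}"]) simp
    next
      case False
      then have "{a} \<subseteq> join_primes L" using prime a by simp
      moreover have "least L a (Upper L {a})"
        by (rule least_UpperI) (use a in \<open>auto simp: Upper_def\<close>)
      ultimately show ?thesis by blast
    qed
  qed
qed

lemma finite_chain_type_prime_forest:
  assumes "finite_chain_type L"
  shows "prime_forest_lattice L"
proof -
  interpret total_order L using assms by (simp add: finite_chain_type_def)
  show ?thesis
    using assms finite_has_least by (intro chain_prime_forest) (simp_all add: finite_chain_type_def)
qed

text \<open>
  The least element corresponds to \<open>\<infinity>\<close>, the greatest of the extended natural numbers.
\<close>

lemma infinite_chain_type_prime_forest:
  assumes "infinite_chain_type L"
  shows "prime_forest_lattice L"
proof -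
  obtain f where f: "bij_betw f (carrier L) UNIV"
    and le: "\<And>x y. x \<in> carrier L \<Longrightarrow> y \<in> carrier L \<Longrightarrow> x \<sqsubseteq>\<^bsub>L\<^esub> y \<longleftrightarrow> f y \<le> (f x :: enat)"
    using assms by (auto simp: infinite_chain_type_def order_isomorphic_def order_emb_def enat_order_def)
  obtain z where z: "z \<in> carrier L" "f z = \<infinity>"
    using f unfolding bij_betw_def by (metis UNIV_I imageE)
  then have "least L z (carrier L)" using le by (simp add: least_def)
  then show ?thesis
    using assms by (intro chain_prime_forest) (auto simp: infinite_chain_type_def)
qed

section \<open>Finite Boolean lattices\<close>

lemma boolean_type_prime_forest:
  fixes L :: "'a gorder" (structure)
  assumes "boolean_type L"
  shows "prime_forest_lattice L"
proof -
  interpret boolean_lattice L using assms by (simp add: boolean_type_def)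
  have atoms: "q \<sqsubseteq> p" if p: "p \<in> join_primes L" and q: "q \<in> join_primes L" and pq: "p \<sqsubseteq> q" for p q
  proof -
    have c: "p \<in> carrier L" "q \<in> carrier L" using p q by (simp_all add: join_primes_closed)
    obtain p' where p': "p' \<in> carrier L" "p \<sqinter> p' = \<bottom>" "p \<squnion> p' = \<top>" using complement[OF c(1)] by blast
    have "\<not> q \<sqsubseteq> p'"
    proof
      assume "q \<sqsubseteq> p'"
      then have "p \<sqsubseteq> p'" using le_trans[OF pq] c p' by simp
      then have "p \<sqsubseteq> \<bottom>" using meet_le[of p p p'] c p' by simp
      then show False using join_prime_not_le_least[OF p bottom_least] by simp
    qed
    moreover have "q \<sqsubseteq> p \<squnion> p'" using p' c by simp
    ultimately show ?thesis using join_prime_le_join_iff[OF q c(1) p'(1)] by blast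
  qed
  show ?thesis
  proof (rule finite_prime_forestI)
    show "finite (carrier L)" using assms by (simp add: boolean_type_def)
    fix p q r assume J: "p \<in> join_primes L" "q \<in> join_primes L" "r \<in> join_primes L" "p \<sqsubseteq> q" "p \<sqsubseteq> r"
    show "q \<sqsubseteq> r \<or> r \<sqsubseteq> q"
      using J atoms[of p q] le_trans[of q p r] J(1-3)[THEN join_primes_closed] by simp
  qed
qed

section \<open>Subdirectly irreducible distributive p-algebras\<close>

text \<open>
  The monolith is contained in both congruences unless one of them is the identity.
\<close>

lemma subdirectly_irreducible_disjoint_congruences:
  assumes si: "p_subdirectly_irreducible L pc"
    and c: "p_congruence L pc \<theta>" "p_congruence L pc \<phi>" and disj: "\<theta> \<inter> \<phi> \<subseteq> Id"
  shows "\<theta> = Id_on (carrier L) \<or> \<phi> = Id_on (carrier L)"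
proof (rule ccontr)
  assume "\<not> ?thesis"
  then obtain \<mu> where mu: "p_congruence L pc \<mu>" "\<mu> \<noteq> Id_on (carrier L)" "\<mu> \<subseteq> \<theta> \<inter> \<phi>"
    using si c unfolding p_subdirectly_irreducible_def by blast
  have "equiv (carrier L) \<mu>" using mu by (simp add: p_congruence_def)
  then have "Id_on (carrier L) \<subseteq> \<mu>" "\<mu> \<subseteq> carrier L \<times> carrier L"
    by (auto simp: equiv_def refl_on_def)
  then have "\<mu> = Id_on (carrier L)" using mu(3) disj by blast
  then show False using mu(2) by simp
qed

context distributive_p_algebra
begin

text \<open>
  For \<open>a \<sqsubseteq> b\<close>, this is the lattice congruence generated by identifying \<open>a\<close> with \<open>b\<close>.
\<close>

definition interval_congruence :: "'a \<Rightarrow> 'a \<Rightarrow> ('a \<times> 'a) set" where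
  "interval_congruence a b =
    {(x, y). x \<in> carrier L \<and> y \<in> carrier L \<and> x \<sqinter> a = y \<sqinter> a \<and> x \<squnion> b = y \<squnion> b}"

lemma interval_congruence_is_congruence:
  assumes a: "a \<in> carrier L" and b: "b \<in> carrier L"
    and pc: "\<And>x y. \<lbrakk>x \<in> carrier L; y \<in> carrier L; x \<sqinter> a = y \<sqinter> a\<rbrakk>
      \<Longrightarrow> pc x \<sqinter> a = pc y \<sqinter> a \<and> pc x \<squnion> b = pc y \<squnion> b"
  shows "p_congruence L pc (interval_congruence a b)"
proof -
  have mm: "(x \<sqinter> u) \<sqinter> c = (y \<sqinter> v) \<sqinter> c"
    if "x \<in> carrier L" "u \<in> carrier L" "y \<in> carrier L" "v \<in> carrier L" "c \<in> carrier L"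
      and "x \<sqinter> c = y \<sqinter> c" "u \<sqinter> c = v \<sqinter> c" for x u y v c
  proof -
    have "(x \<sqinter> u) \<sqinter> c = x \<sqinter> (u \<sqinter> c)" using that(1-5) by (simp add: meet_assoc)
    also have "\<dots> = (x \<sqinter> c) \<sqinter> v" using that(1-5) by (simp add: that(7) meet_assoc meet_comm[of L v c])
    also have "\<dots> = (y \<sqinter> v) \<sqinter> c" using that(1-5) by (simp add: that(6) meet_assoc meet_comm[of L v c])
    finally show ?thesis .
  qed
  have jj: "(x \<squnion> u) \<squnion> c = (y \<squnion> v) \<squnion> c"
    if "x \<in> carrier L" "u \<in> carrier L" "y \<in> carrier L" "v \<in> carrier L" "c \<in> carrier L"
      and "x \<squnion> c = y \<squnion> c" "u \<squnion> c = v \<squnion> c" for x u y v c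
  proof -
    have "(x \<squnion> u) \<squnion> c = x \<squnion> (u \<squnion> c)" using that(1-5) by (simp add: join_assoc)
    also have "\<dots> = (x \<squnion> c) \<squnion> v" using that(1-5) by (simp add: that(7) join_assoc join_comm[of L v c])
    also have "\<dots> = (y \<squnion> v) \<squnion> c" using that(1-5) by (simp add: that(6) join_assoc join_comm[of L v c])
    finally show ?thesis .
  qed
  have mj: "(x \<sqinter> u) \<squnion> c = (y \<sqinter> v) \<squnion> c"
    if "x \<in> carrier L" "u \<in> carrier L" "y \<in> carrier L" "v \<in> carrier L" "c \<in> carrier L"
      and "x \<squnion> c = y \<squnion> c" "u \<squnion> c = v \<squnion> c" for x u y v c
    using that join_meet_distrib[of c x u] join_meet_distrib[of c y v] by (simp add: join_comm[of L c])
  have jm: "(x \<squnion> u) \<sqinter> c = (y \<squnion> v) \<sqinter> c"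
    if "x \<in> carrier L" "u \<in> carrier L" "y \<in> carrier L" "v \<in> carrier L" "c \<in> carrier L"
      and "x \<sqinter> c = y \<sqinter> c" "u \<sqinter> c = v \<sqinter> c" for x u y v c
    using that meet_join_distrib[of c x u] meet_join_distrib[of c y v] by (simp add: meet_comm[of L c])
  have "equiv (carrier L) (interval_congruence a b)"
    by (auto simp: equiv_def refl_on_def sym_def trans_def interval_congruence_def)
  moreover have "(pc x, pc y) \<in> interval_congruence a b" if "(x, y) \<in> interval_congruence a b" for x y
    using that pc pc_closed by (simp add: interval_congruence_def)
  moreover have "(x \<sqinter> u, y \<sqinter> v) \<in> interval_congruence a b \<and> (x \<squnion> u, y \<squnion> v) \<in> interval_congruence a b"
    if "(x, y) \<in> interval_congruence a b" "(u, v) \<in> interval_congruence a b" for x y u v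
  proof -
    have c: "x \<in> carrier L" "u \<in> carrier L" "y \<in> carrier L" "v \<in> carrier L"
      and e: "x \<sqinter> a = y \<sqinter> a" "u \<sqinter> a = v \<sqinter> a" "x \<squnion> b = y \<squnion> b" "u \<squnion> b = v \<squnion> b"
      using that by (simp_all add: interval_congruence_def)
    show ?thesis
      using mm[OF c a e(1,2)] jm[OF c a e(1,2)] mj[OF c b e(3,4)] jj[OF c b e(3,4)] c
      by (simp add: interval_congruence_def)
  qed
  ultimately show ?thesis unfolding p_congruence_def by blast
qed

lemma pc_meet_le:
  assumes c: "x \<in> carrier L" "y \<in> carrier L" "a \<in> carrier L" and e: "x \<sqinter> a = y \<sqinter> a"
  shows "y \<sqinter> (pc x \<sqinter> a) = \<bottom>"
proof -
  have px: "pc x \<in> carrier L" using c pc_closed by simp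
  have "y \<sqinter> (pc x \<sqinter> a) = (y \<sqinter> a) \<sqinter> pc x"
    using c px by (simp add: meet_assoc meet_comm[of L a])
  also have "\<dots> = (x \<sqinter> pc x) \<sqinter> a"
    using c px by (simp add: e[symmetric] meet_assoc meet_comm[of L a])
  also have "x \<sqinter> pc x = \<bottom>" using pc_iff[OF c(1) px] px by simp
  also have "\<bottom> \<sqinter> a = \<bottom>" using bottom_meet[OF c(3)] eq_is_equal by simp
  finally show ?thesis .
qed

text \<open>
  If \<open>b\<close> is the top, then only the meets with \<open>a\<close> matter, and \<open>x\<^sup>* \<sqinter> a\<close> depends only on
  \<open>x \<sqinter> a\<close>: an element below \<open>a\<close> is disjoint from \<open>x\<close> if and only if it is disjoint from \<open>x \<sqinter> a\<close>.
\<close>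

lemma interval_to_top_congruence:
  assumes a: "a \<in> carrier L"
  shows "p_congruence L pc (interval_congruence a \<top>)"
proof (rule interval_congruence_is_congruence[OF a top_closed])
  fix x y assume c: "x \<in> carrier L" "y \<in> carrier L" and e: "x \<sqinter> a = y \<sqinter> a"
  have le: "pc x \<sqinter> a \<sqsubseteq> pc y \<sqinter> a"
    if c: "x \<in> carrier L" "y \<in> carrier L" and e: "x \<sqinter> a = y \<sqinter> a" for x y
    using pc_meet_le[OF c a e] pc_iff[of y "pc x \<sqinter> a"] c a pc_closed meet_right[of "pc x" a]
    by (intro meet_le) simp_all
  have "pc x \<sqinter> a = pc y \<sqinter> a"
    using le[OF c e] le[OF c(2,1) e[symmetric]] c a pc_closed by (intro le_antisym) simp_all
  moreover have "pc z \<squnion> \<top> = \<top>" if "z \<in> carrier L" for z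
    using le_iff_meet[of "pc z" \<top>] that pc_closed by simp
  ultimately show "pc x \<sqinter> a = pc y \<sqinter> a \<and> pc x \<squnion> \<top> = pc y \<squnion> \<top>" using c by simp
qed

text \<open>
  If \<open>a\<close> is dense, then \<open>x\<^sup>* = (x \<sqinter> a)\<^sup>*\<close>. So pseudocomplements of elements that have the
  same meet with \<open>a\<close> are equal.
\<close>

lemma interval_above_dense_congruence:
  assumes a: "a \<in> carrier L" and b: "b \<in> carrier L"
    and dense: "\<And>z. \<lbrakk>z \<in> carrier L; z \<sqinter> a = \<bottom>\<rbrakk> \<Longrightarrow> z = \<bottom>"
  shows "p_congruence L pc (interval_congruence a b)"
proof (rule interval_congruence_is_congruence[OF a b])
  fix x y assume c: "x \<in> carrier L" "y \<in> carrier L" and e: "x \<sqinter> a = y \<sqinter> a"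
  have le: "pc x \<sqsubseteq> pc y" if c: "x \<in> carrier L" "y \<in> carrier L" and e: "x \<sqinter> a = y \<sqinter> a" for x y
  proof -
    have "(y \<sqinter> pc x) \<sqinter> a = \<bottom>"
      using pc_meet_le[OF c a e] c a pc_closed by (simp add: meet_assoc)
    then have "y \<sqinter> pc x = \<bottom>" using dense c pc_closed by simp
    then show ?thesis using pc_iff c pc_closed by simp
  qed
  have "pc x = pc y"
    using le[OF c e] le[OF c(2,1) e[symmetric]] c pc_closed by (intro le_antisym) simp_all
  then show "pc x \<sqinter> a = pc y \<sqinter> a \<and> pc x \<squnion> b = pc y \<squnion> b" by simp
qed

lemma interval_congruence_nontrivial:
  assumes "a \<in> carrier L" "b \<in> carrier L" "a \<sqsubseteq> b" "a \<noteq> b"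
  shows "interval_congruence a b \<noteq> Id_on (carrier L)"
proof -
  have "(a, b) \<in> interval_congruence a b"
    using assms le_iff_join[of a b] le_iff_join[of a a] le_iff_meet[of a b] le_iff_meet[of b b]
    by (simp add: interval_congruence_def meet_comm[of L b a])
  then show ?thesis using assms(4) by (metis Id_onE prod.inject)
qed

text \<open>
  By distributivity, an element is determined by its meets with \<open>a\<close> and with \<open>b\<close> if \<open>a \<squnion> b\<close> is the
  top. The congruences that collapse \<open>a\<close>, respectively \<open>b\<close>, to the top then intersect in the
  identity, so one of them is trivial.
\<close>

lemma subdirectly_irreducible_top_join_irreducible:
  assumes si: "p_subdirectly_irreducible L pc"
    and c: "a \<in> carrier L" "b \<in> carrier L" and j: "a \<squnion> b = \<top>"
  shows "a = \<top> \<or> b = \<top>"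
proof -
  have "x = y" if "(x, y) \<in> interval_congruence a \<top>" "(x, y) \<in> interval_congruence b \<top>" for x y
  proof -
    have e: "x \<in> carrier L" "y \<in> carrier L" "x \<sqinter> a = y \<sqinter> a" "x \<sqinter> b = y \<sqinter> b"
      using that by (simp_all add: interval_congruence_def)
    have "z \<sqinter> (a \<squnion> b) = z" if "z \<in> carrier L" for z
      using le_iff_join[of z \<top>] that by (simp add: j)
    then show ?thesis
      using e meet_join_distrib[OF e(1) c] meet_join_distrib[OF e(2) c] by simp
  qed
  then have "interval_congruence a \<top> \<inter> interval_congruence b \<top> \<subseteq> Id" by auto
  from subdirectly_irreducible_disjoint_congruences[OF si interval_to_top_congruence[OF c(1)]
      interval_to_top_congruence[OF c(2)] this]
  show ?thesis
    using interval_congruence_nontrivial[of _ \<top>] c by auto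
qed

text \<open>
  Collapsing \<open>a\<close> with \<open>a \<squnion> q\<close> and collapsing \<open>a \<squnion> q\<close> with the top are congruences that
  intersect in the identity, by uniqueness of relative complements. If \<open>q\<close> is not below \<open>a\<close>, then
  the first is nontrivial, so \<open>a \<squnion> q\<close> is the top, which is join-irreducible.
\<close>

lemma subdirectly_irreducible_dense_above_nontop:
  assumes si: "p_subdirectly_irreducible L pc"
    and a: "a \<in> carrier L" and dense: "\<And>z. \<lbrakk>z \<in> carrier L; z \<sqinter> a = \<bottom>\<rbrakk> \<Longrightarrow> z = \<bottom>"
    and q: "q \<in> carrier L" "q \<noteq> \<top>"
  shows "q \<sqsubseteq> a"
proof (rule ccontr)
  assume nle: "\<not> q \<sqsubseteq> a"
  let ?b = "a \<squnion> q"
  have b: "?b \<in> carrier L" using a q by simp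
  have ab: "a \<sqsubseteq> ?b" "a \<noteq> ?b" using nle join_left[OF a q(1)] join_right[OF a q(1)] by auto
  have "interval_congruence a ?b \<inter> interval_congruence ?b \<top> \<subseteq> Id"
    using relative_complement_unique[OF _ _ b] by (auto simp: interval_congruence_def)
  from subdirectly_irreducible_disjoint_congruences[OF si interval_above_dense_congruence[OF a b dense]
      interval_to_top_congruence[OF b] this]
  have "?b = \<top>"
    using interval_congruence_nontrivial[OF a b ab] interval_congruence_nontrivial[OF b top_closed] b by auto
  then have "a = \<top>" using subdirectly_irreducible_top_join_irreducible[OF si a q(1)] q(2) by blast
  then show False using nle q by simp
qed

end

text \<open>
  For a join-prime \<open>p\<close>, the element \<open>p \<squnion> p\<^sup>*\<close> is dense and thus lies above every element except the top. A
  join-prime \<open>q\<close> above \<open>p\<close> other than the top is therefore below \<open>p\<close>, since it cannot be below \<open>p\<^sup>*\<close>.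
\<close>

lemma p_algebra_type_prime_forest:
  fixes L :: "'a gorder" (structure)
  assumes "p_algebra_type L"
  shows "prime_forest_lattice L"
proof -
  obtain pc where p: "distributive_p_algebra L pc" and si: "p_subdirectly_irreducible L pc"
    using assms by (auto simp: p_algebra_type_def)
  interpret distributive_p_algebra L pc by (rule p)
  have top: "q = \<top> \<or> q \<sqsubseteq> p" if p: "p \<in> join_primes L" and q: "q \<in> join_primes L" and pq: "p \<sqsubseteq> q" for p q
  proof (rule disjCI)
    have c: "p \<in> carrier L" "q \<in> carrier L" "pc p \<in> carrier L" using p q by (simp_all add: join_primes_closed pc_closed)
    let ?a = "p \<squnion> pc p"
    have a: "?a \<in> carrier L" using c by simp
    have dense: "z = \<bottom>" if z: "z \<in> carrier L" and m: "z \<sqinter> ?a = \<bottom>" for z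
    proof -
      have le: "z \<sqinter> w \<sqsubseteq> \<bottom>" if w: "w \<in> carrier L" "w \<sqsubseteq> ?a" for w
      proof -
        have "z \<sqinter> w \<sqsubseteq> z \<sqinter> ?a"
          using meet_left[OF z w(1)] le_trans[OF meet_right[OF z w(1)] w(2)] z w a by (intro meet_le) simp_all
        then show ?thesis using m by simp
      qed
      have "z \<sqinter> p = \<bottom>"
        using le[OF c(1) join_left[OF c(1,3)]] z c by (intro le_antisym) simp_all
      then have "z \<sqsubseteq> pc p" using pc_iff[OF c(1) z] meet_comm[of L z p] by simp
      then have "z \<sqinter> pc p = z" using le_iff_join[OF z c(3)] by simp
      then have "z \<sqsubseteq> \<bottom>" using le[OF c(3) join_right[OF c(1,3)]] by simp
      then show ?thesis using z by (intro le_antisym) simp_all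
    qed
    assume "\<not> q \<sqsubseteq> p"
    show "q = \<top>"
    proof (rule ccontr)
      assume "q \<noteq> \<top>"
      then have "q \<sqsubseteq> ?a"
        using subdirectly_irreducible_dense_above_nontop[OF si a dense c(2)] by blast
      then have "q \<sqsubseteq> pc p" using join_prime_le_join_iff[OF q c(1,3)] \<open>\<not> q \<sqsubseteq> p\<close> by blast
      then have "p \<sqsubseteq> pc p" using le_trans[OF pq] c by simp
      then have "p \<sqinter> p = \<bottom>" using pc_iff[OF c(1,1)] by simp
      then have "p \<sqsubseteq> \<bottom>" using meet_le[of p p p] c by simp
      then show False using join_prime_not_le_least[OF p bottom_least] by simp
    qed
  qed
  show ?thesis
  proof (rule finite_prime_forestI)
    show "finite (carrier L)" using assms by (simp add: p_algebra_type_def)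
    fix p q r assume J: "p \<in> join_primes L" "q \<in> join_primes L" "r \<in> join_primes L" "p \<sqsubseteq> q" "p \<sqsubseteq> r"
    then have c: "p \<in> carrier L" "q \<in> carrier L" "r \<in> carrier L" by (simp_all add: join_primes_closed)
    from top[OF J(1,2,4)] show "q \<sqsubseteq> r \<or> r \<sqsubseteq> q"
      using le_trans[of q p r] J(5) c by auto
  qed
qed

section \<open>Realising products as lattices of compact open sets\<close>

lemma root_system_primes:
  assumes D: "\<And>i. i \<in> I \<Longrightarrow> prime_forest_lattice (D i)"
  shows "root_system (prime_index I D) (prime_order D)"
proof
  have po: "partial_order (D i)" if "i \<in> I" for i
    using D[OF that] by (simp add: prime_forest_lattice_def lattice_def upper_semilattice_def)
  have wpo: "weak_partial_order (D i)" if "i \<in> I" for i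
    using po[OF that] by (simp add: partial_order_def)
  have car: "fst u \<in> I \<and> snd u \<in> join_primes (D (fst u)) \<and> snd u \<in> carrier (D (fst u))"
    if "u \<in> prime_index I D" for u
    using that by (auto simp: prime_index_def join_primes_closed)
  fix a b c assume a: "a \<in> prime_index I D"
  show "prime_order D a a"
    using car[OF a] weak_partial_order.le_refl[OF wpo] by (simp add: prime_order_def)
  assume b: "b \<in> prime_index I D"
  show "a = b" if "prime_order D a b" "prime_order D b a"
    using that car[OF a] car[OF b] partial_order.le_antisym[OF po, of "fst a" "snd a" "snd b"]
    by (auto simp: prime_order_def prod_eq_iff)
  assume c: "c \<in> prime_index I D"
  show "prime_order D a c" if "prime_order D a b" "prime_order D b c"
    using that car[OF a] car[OF b] car[OF c]
      weak_partial_order.le_trans[OF wpo, of "fst a" "snd a" "snd b" "snd c"]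
    by (auto simp: prime_order_def)
  show "prime_order D b c \<or> prime_order D c b" if "prime_order D a b" "prime_order D a c"
    using that car[OF a] car[OF b] car[OF c]
      prime_forest_lattice.primes_above_chain[OF D, of "fst a" "snd a" "snd b" "snd c"]
    by (auto simp: prime_order_def)
qed

text \<open>
  The root system of join-primes of all factors consists of pairs; currying the functions on it gives
  the type of \<open>A\<close>.
\<close>

theorem prime_forest_product_is_spectral:
  fixes D :: "'i \<Rightarrow> 'a gorder"
  assumes I: "finite I" and D: "\<And>i. i \<in> I \<Longrightarrow> prime_forest_lattice (D i)"
  shows "\<exists>A :: ('i \<Rightarrow> 'a \<Rightarrow> int) bck. commutative_bck A \<and>
           lattice_isomorphic (product_order I D) (compact_open_lattice A)"
proof -
  interpret root_system "prime_index I D" "prime_order D"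
    using D by (rule root_system_primes)
  let ?A = "relabel_bck curry case_prod hahn_cone :: ('i \<Rightarrow> 'a \<Rightarrow> int) bck"
  let ?s = "\<lambda>f :: 'i \<Rightarrow> 'a \<Rightarrow> int. shadow (case_prod f)"
  interpret A: supported_bck ?A ?s
    using supported_bck_hahn_cone by (rule supported_bck_relabel) simp
  have "?s ` carrier ?A = shadow ` carrier hahn_cone"
    by (simp add: relabel_bck_def image_image)
  also have "\<dots> = primes_below I D ` carrier (product_order I D)"
    using shadows_eq_finite_down_sets primes_below_image[OF I D] by simp
  finally have "lattice_isomorphic (product_order I D) (compact_open_lattice ?A)"
    using D by (intro A.lattice_isomorphic_compact_opens[of _ "primes_below I D"]
        lattice_product_order primes_below_subset_iff) (auto simp: prime_forest_lattice_def)
  then show ?thesis using A.commutative_bck_axioms by blast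
qed

(* HOL has no existential quantifier over types, so the carrier of A is taken inside the fixed
   type nat => 'a => int. It is uncountable for every 'a, so every countable algebra has a copy
   in it. *)
theorem corollary5p15:
  fixes D :: "nat \<Rightarrow> 'a gorder" and n :: nat
  assumes "\<And>j. j \<in> {1..n} \<Longrightarrow> distributive_lattice (D j)"
    and "\<And>j. j \<in> {1..n} \<Longrightarrow>
           tree_type (D j) \<or> finite_chain_type (D j) \<or> infinite_chain_type (D j) \<or>
           p_algebra_type (D j) \<or> boolean_type (D j)"
  shows "\<exists>A :: (nat \<Rightarrow> 'a \<Rightarrow> int) bck. commutative_bck A \<and>
           lattice_isomorphic (product_order {1..n} D) (compact_open_lattice A)"
proof (rule prime_forest_product_is_spectral)
  fix j assume "j \<in> {1..n}"
  then show "prime_forest_lattice (D j)"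
    using assms(2)[of j] tree_type_prime_forest finite_chain_type_prime_forest
      infinite_chain_type_prime_forest p_algebra_type_prime_forest boolean_type_prime_forest
    by blast
qed simp

end
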